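(* Let $K$ be a field, let $\alpha\in K$ with $\alpha\ne0$, and let $L_{10}$ be the three-dimensional Leibniz algebra over $K$ with basis $\{e_1,e_2,e_3\}$ and nonzero products of basis elements $e_1e_3=e_2$, $e_2e_3=\alpha e_1+e_2$. Let $\mathcal B_{L_{10}}\subset\mathcal L\langle X\rangle$ be the set of all monomials of the form \[ x_{j_1}^{(m_1)}x_{j_2}^{(m_2)}\cdots x_{j_n}^{(m_n)}\qquad (n\ge1,\ m_i\ge1,\ j_2<j_3<\dots<j_n,\ j_1\ne j_k\text{ for all }k\ge2). \] If $K$ is infinite, then the images of $\mathcal B_{L_{10}}$ in the relatively free algebra $\mathcal L\langle X\rangle/T(L_{10})$ form a basis of this algebra. If $K$ is finite with $|K|=q$, then the images of the monomials of $\mathcal B_{L_{10}}$ subject to $m_i<q$ for all $i=3,\dots,n$ and to the following additional restrictions form a basis of $\mathcal L\langle X\rangle/T(L_{10})$: (1) if the polynomial $p(t)=t^2-t-\alpha$ has distinct roots in $K$: $m_1\le q$ and $m_2<q$; (2) otherwise (i.e. if $p(t)$ has no roots in $K$ or has a double root in $K$): $m_2<2q-1$ if $m_1=1$, and in all other cases $m_2<q$ and $1<m_1<2q$. Moreover, the codimension sequence of $L_{10}$ satisfies $c_n(L_{10})=n$ for all $n\ge1$, and the exponent of $L_{10}$ is equal to $1$.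
   Context: A (right) Leibniz algebra over $K$ is a $K$-algebra satisfying $x(yz)=(xy)z-(xz)y$. $\mathcal L\langle X\rangle$ is the free Leibniz algebra over $K$ on $X=\{x_1,x_2,\dots\}$; $T(L)$ is the ideal of polynomials vanishing under all substitutions of elements of $L$. Products without brackets are left-normed, and $x^{(m)}$ means $m$ consecutive occurrences of $x$ in a left-normed product; thus $x_{j_1}^{(m_1)}x_{j_2}^{(m_2)}\cdots$ is the left-normed product of $m_1$ copies of $x_{j_1}$, then $m_2$ copies of $x_{j_2}$, etc. (conditions on $m_2$ are void when $n=1$). $P_n\subset\mathcal L\langle X\rangle$ is the space of multilinear polynomials in $x_1,\dots,x_n$, $c_n(L)=\dim_K P_n/(P_n\cap T(L))$, and the exponent of $L$ is $\exp(L)=\lim_{n\to\infty}\sqrt[n]{c_n(L)}$. Products of basis elements not listed are zero. *)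

theory Defs
  imports "HOL-Analysis.Cartesian_Space" "HOL-Library.Poly_Mapping" "HOL-Library.Set_Algebras"
    "HOL-Computational_Algebra.Polynomial"
begin

section \<open>Bases and dimensions of quotient spaces\<close>

text \<open>
  For a subspace \<open>U\<close>, the image of \<open>v\<close> modulo \<open>U\<close> is the coset \<open>v +o U\<close>. Addition of cosets is the
  elementwise addition of sets.
\<close>

locale vector_space_quotients = vector_space scale
  for scale :: "'a::field \<Rightarrow> 'b::ab_group_add \<Rightarrow> 'b"
begin

definition quotient_space :: "'b set \<Rightarrow> 'b set \<Rightarrow> 'b set set" where
  "quotient_space W U = (\<lambda>w. w +o U) ` W"

text \<open>Adding \<open>U\<close> matters for \<open>c = 0\<close> only, where \<open>scale c ` A\<close> is \<open>{0}\<close> instead of the coset \<open>U\<close>.\<close>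

definition quotient_scale :: "'b set \<Rightarrow> 'a \<Rightarrow> 'b set \<Rightarrow> 'b set" where
  "quotient_scale U c A = scale c ` A + U"

text \<open>
  The sum below is the one of sets, whose neutral element is \<open>{0}\<close>; the summand \<open>U\<close> (the zero of the
  quotient) turns the empty combination into \<open>U\<close> and changes nothing otherwise.
\<close>

definition quotient_comb :: "'b set \<Rightarrow> ('b set \<Rightarrow> 'a) \<Rightarrow> 'b set set \<Rightarrow> 'b set" where
  "quotient_comb U c F = (\<Sum>A\<in>F. quotient_scale U (c A) A) + U"

definition quotient_independent :: "'b set \<Rightarrow> 'b set set \<Rightarrow> bool" where
  "quotient_independent U C \<longleftrightarrow>
     (\<forall>F c. finite F \<and> F \<subseteq> C \<and> quotient_comb U c F = U \<longrightarrow> (\<forall>A\<in>F. c A = 0))"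

definition quotient_basis :: "'b set \<Rightarrow> 'b set \<Rightarrow> 'b set set \<Rightarrow> bool" where
  "quotient_basis W U C \<longleftrightarrow> C \<subseteq> quotient_space W U \<and> quotient_independent U C \<and>
     (\<forall>A\<in>quotient_space W U. \<exists>F c. finite F \<and> F \<subseteq> C \<and> A = quotient_comb U c F)"

definition images_form_basis :: "'b set \<Rightarrow> 'b set \<Rightarrow> 'b set \<Rightarrow> bool" where
  "images_form_basis W U B \<longleftrightarrow>
     inj_on (\<lambda>b. b +o U) B \<and> quotient_basis W U ((\<lambda>b. b +o U) ` B)"

definition quotient_dim :: "'b set \<Rightarrow> 'b set \<Rightarrow> nat" where
  "quotient_dim W U = card (SOME C. quotient_basis W U C)"

lemma quotient_scale_coset:
  assumes "subspace U"
  shows "quotient_scale U c (v +o U) = scale c v +o U"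
proof -
  have "scale c (v + u) + u' \<in> scale c v +o U" if "u \<in> U" "u' \<in> U" for u u'
    unfolding elt_set_plus_def using that assms
    by (auto intro!: bexI[of _ "scale c u + u'"] simp: scale_right_distrib add.assoc
        intro: subspace_add subspace_scale)
  moreover have "scale c v + u \<in> quotient_scale U c (v +o U)" if "u \<in> U" for u
    unfolding quotient_scale_def
    using that subspace_0[OF assms] by (intro set_plus_intro imageI) (auto simp: elt_set_plus_def)
  ultimately show ?thesis
    by (auto simp: quotient_scale_def elt_set_plus_def set_plus_def)
qed

lemma coset_plus_coset:
  assumes "subspace U"
  shows "(v +o U) + (w +o U) = (v + w) +o U"
proof -
  have "U + U = U"
    using assms subspace_0[OF assms] by (force simp: set_plus_def intro: subspace_add)
  then show ?thesis
    by (metis set_plus_rearrange)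
qed

lemma quotient_comb_coset:
  assumes "subspace U" "finite F" "inj_on (\<lambda>b. b +o U) F"
  shows "quotient_comb U c ((\<lambda>b. b +o U) ` F) = (\<Sum>b\<in>F. scale (c (b +o U)) b) +o U"
  using assms(2,3)
proof (induction F rule: finite_induct)
  case empty
  then show ?case by (simp add: quotient_comb_def)
next
  case (insert x F)
  have "x +o U \<notin> (\<lambda>b. b +o U) ` F"
    using insert by (auto simp: inj_on_def)
  then have "quotient_comb U c ((\<lambda>b. b +o U) ` insert x F)
      = quotient_scale U (c (x +o U)) (x +o U) + quotient_comb U c ((\<lambda>b. b +o U) ` F)"
    using insert by (simp add: quotient_comb_def add.assoc)
  then show ?case
    using insert by (simp add: quotient_scale_coset coset_plus_coset assms(1))
qed

end


section \<open>Leibniz algebras\<close>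

locale leibniz_algebra = vector_space_quotients scale
  for scale :: "'a::field \<Rightarrow> 'b::ab_group_add \<Rightarrow> 'b" +
  fixes mult :: "'b \<Rightarrow> 'b \<Rightarrow> 'b"
  assumes mult_add_left: "mult (x + y) z = mult x z + mult y z"
    and mult_add_right: "mult x (y + z) = mult x y + mult x z"
    and mult_scale_left: "mult (scale c x) y = scale c (mult x y)"
    and mult_scale_right: "mult x (scale c y) = scale c (mult x y)"
    and leibniz: "mult x (mult y z) = mult (mult x y) z - mult (mult x z) y"
begin

lemma mult_zero_left [simp]: "mult 0 y = 0"
  using mult_add_left[of 0 0 y] by simp

lemma mult_zero_right [simp]: "mult x 0 = 0"
  using mult_add_right[of x 0 0] by simp

lemma mult_sum_left: "mult (\<Sum>i\<in>A. f i) y = (\<Sum>i\<in>A. mult (f i) y)"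
  by (induction A rule: infinite_finite_induct) (auto simp: mult_add_left)

lemma mult_sum_right: "mult x (\<Sum>i\<in>A. f i) = (\<Sum>i\<in>A. mult x (f i))"
  by (induction A rule: infinite_finite_induct) (auto simp: mult_add_right)

end


section \<open>The free Leibniz algebra\<close>

text \<open>
  Bracketed monomials in the free generators; \<open>Var i\<close> stands for \<open>x\<^bsub>i+1\<^esub>\<close>. Their finitely
  supported combinations form the free nonassociative algebra.
\<close>

datatype magma = Var nat | Mul magma magma

primrec leaves :: "magma \<Rightarrow> nat list" where
  "leaves (Var i) = [i]"
| "leaves (Mul a b) = leaves a @ leaves b"

type_synonym 'k nonassoc = "magma \<Rightarrow>\<^sub>0 'k"

definition na_scale :: "'k::field \<Rightarrow> 'k nonassoc \<Rightarrow> 'k nonassoc" where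
  "na_scale c p = Poly_Mapping.map ((*) c) p"

definition na_mult :: "'k::field nonassoc \<Rightarrow> 'k nonassoc \<Rightarrow> 'k nonassoc" where
  "na_mult p q = (\<Sum>a\<in>Poly_Mapping.keys p. \<Sum>b\<in>Poly_Mapping.keys q. 
     Poly_Mapping.single (Mul a b) (Poly_Mapping.lookup p a * Poly_Mapping.lookup q b))"

lemma lookup_na_scale [simp]:
  "Poly_Mapping.lookup (na_scale c p) m = c * Poly_Mapping.lookup p m"
  by (auto simp: na_scale_def Poly_Mapping.map.rep_eq when_def)

lemma na_mult_superset:
  assumes "finite A" "finite B" "Poly_Mapping.keys p \<subseteq> A" "Poly_Mapping.keys q \<subseteq> B"
  shows "na_mult p q = (\<Sum>a\<in>A. \<Sum>b\<in>B. 
     Poly_Mapping.single (Mul a b) (Poly_Mapping.lookup p a * Poly_Mapping.lookup q b))"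
proof -
  have "na_mult p q = (\<Sum>a\<in>Poly_Mapping.keys p. \<Sum>b\<in>B. 
     Poly_Mapping.single (Mul a b) (Poly_Mapping.lookup p a * Poly_Mapping.lookup q b))"
    unfolding na_mult_def using assms
    by (intro sum.cong refl sum.mono_neutral_left) (auto simp: in_keys_iff)
  also have "\<dots> = (\<Sum>a\<in>A. \<Sum>b\<in>B. 
     Poly_Mapping.single (Mul a b) (Poly_Mapping.lookup p a * Poly_Mapping.lookup q b))"
    using assms by (intro sum.mono_neutral_left) (auto simp: in_keys_iff)
  finally show ?thesis .
qed

lemma na_mult_add_left: "na_mult (p + p') q = na_mult p q + na_mult p' q"
proof -
  let ?A = "Poly_Mapping.keys p \<union> Poly_Mapping.keys p'" and ?B = "Poly_Mapping.keys q"
  have "Poly_Mapping.keys (p + p') \<subseteq> ?A"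
    by (rule Poly_Mapping.keys_add)
  then show ?thesis
    by (subst (1 2 3) na_mult_superset[of ?A ?B])
      (auto simp: lookup_add distrib_right single_add sum.distrib)
qed

lemma na_mult_add_right: "na_mult p (q + q') = na_mult p q + na_mult p q'"
proof -
  let ?A = "Poly_Mapping.keys p" and ?B = "Poly_Mapping.keys q \<union> Poly_Mapping.keys q'"
  have "Poly_Mapping.keys (q + q') \<subseteq> ?B"
    by (rule Poly_Mapping.keys_add)
  then show ?thesis
    by (subst (1 2 3) na_mult_superset[of ?A ?B])
      (auto simp: lookup_add distrib_left single_add sum.distrib)
qed

interpretation na: vector_space na_scale
  by unfold_locales (auto intro!: poly_mapping_eqI simp: lookup_add algebra_simps)

lemma na_scale_single: "na_scale c (Poly_Mapping.single m d) = Poly_Mapping.single m (c * d)"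
  by (auto intro!: poly_mapping_eqI simp: lookup_single when_def)

lemma na_mult_scale_left: "na_mult (na_scale c p) q = na_scale c (na_mult p q)"
proof -
  have "Poly_Mapping.keys (na_scale c p) \<subseteq> Poly_Mapping.keys p"
    by (auto simp: in_keys_iff)
  then show ?thesis
    by (subst (1 2) na_mult_superset[of "Poly_Mapping.keys p" "Poly_Mapping.keys q"])
      (auto simp: na.scale_sum_right na_scale_single mult.assoc)
qed

lemma na_mult_scale_right: "na_mult p (na_scale c q) = na_scale c (na_mult p q)"
proof -
  have "Poly_Mapping.keys (na_scale c q) \<subseteq> Poly_Mapping.keys q"
    by (auto simp: in_keys_iff)
  then show ?thesis
    by (subst (1 2) na_mult_superset[of "Poly_Mapping.keys p" "Poly_Mapping.keys q"])
      (auto simp: na.scale_sum_right na_scale_single mult.left_commute)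
qed

lemma na_mult_diff_left: "na_mult (p - p') q = na_mult p q - na_mult p' q"
  using na_mult_add_left[of "p - p'" p' q] by (simp add: algebra_simps)

lemma na_mult_diff_right: "na_mult p (q - q') = na_mult p q - na_mult p q'"
  using na_mult_add_right[of p "q - q'" q'] by (simp add: algebra_simps)

inductive_set leibniz_ideal :: "'k::field nonassoc set" where
  zero: "0 \<in> leibniz_ideal"
| gen: "na_mult x (na_mult y z) - (na_mult (na_mult x y) z - na_mult (na_mult x z) y) \<in> leibniz_ideal"
| add: "p \<in> leibniz_ideal \<Longrightarrow> q \<in> leibniz_ideal \<Longrightarrow> p + q \<in> leibniz_ideal"
| scale: "p \<in> leibniz_ideal \<Longrightarrow> na_scale c p \<in> leibniz_ideal"
| mult_left: "p \<in> leibniz_ideal \<Longrightarrow> na_mult r p \<in> leibniz_ideal"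
| mult_right: "p \<in> leibniz_ideal \<Longrightarrow> na_mult p r \<in> leibniz_ideal"

lemma leibniz_ideal_uminus: "p \<in> leibniz_ideal \<Longrightarrow> - p \<in> leibniz_ideal"
  using leibniz_ideal.scale[of p "-1"] by (simp add: na.scale_minus_left)

lemma leibniz_ideal_diff: "p \<in> leibniz_ideal \<Longrightarrow> q \<in> leibniz_ideal \<Longrightarrow> p - q \<in> leibniz_ideal"
  by (metis leibniz_ideal.add leibniz_ideal_uminus diff_conv_add_uminus)

definition leibniz_rel :: "'k::field nonassoc \<Rightarrow> 'k nonassoc \<Rightarrow> bool" where
  "leibniz_rel p q \<longleftrightarrow> p - q \<in> leibniz_ideal"

quotient_type (overloaded) 'k free_leibniz = "'k::field nonassoc" / leibniz_rel
proof (rule equivpI)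
  show "reflp (leibniz_rel :: 'k nonassoc \<Rightarrow> _)"
    by (simp add: reflp_def leibniz_rel_def leibniz_ideal.zero)
  show "symp (leibniz_rel :: 'k nonassoc \<Rightarrow> _)"
    unfolding symp_def leibniz_rel_def by (metis leibniz_ideal_uminus minus_diff_eq)
  show "transp (leibniz_rel :: 'k nonassoc \<Rightarrow> _)"
    unfolding transp_def leibniz_rel_def
    by (metis leibniz_ideal.add diff_add_cancel add_diff_eq)
qed

instantiation free_leibniz :: (field) ab_group_add
begin

lift_definition zero_free_leibniz :: "'a free_leibniz" is 0 .

lift_definition plus_free_leibniz :: "'a free_leibniz \<Rightarrow> 'a free_leibniz \<Rightarrow> 'a free_leibniz" is "(+)"
  unfolding leibniz_rel_def by (metis add_diff_add leibniz_ideal.add)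

lift_definition uminus_free_leibniz :: "'a free_leibniz \<Rightarrow> 'a free_leibniz" is uminus
  unfolding leibniz_rel_def by (metis minus_diff_minus leibniz_ideal_uminus)

lift_definition minus_free_leibniz :: "'a free_leibniz \<Rightarrow> 'a free_leibniz \<Rightarrow> 'a free_leibniz" is "(-)"
proof -
  fix p p' q q' :: "'a nonassoc"
  assume "leibniz_rel p p'" "leibniz_rel q q'"
  moreover have "p - q - (p' - q') = (p - p') - (q - q')"
    by simp
  ultimately show "leibniz_rel (p - q) (p' - q')"
    unfolding leibniz_rel_def by (metis leibniz_ideal_diff)
qed

instance
  by standard (transfer; simp add: leibniz_rel_def leibniz_ideal.zero algebra_simps)+

end

lift_definition fl_scale :: "'k::field \<Rightarrow> 'k free_leibniz \<Rightarrow> 'k free_leibniz" is na_scale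
  unfolding leibniz_rel_def by (metis leibniz_ideal.scale na.scale_right_diff_distrib)

lift_definition fl_mult :: "'k::field free_leibniz \<Rightarrow> 'k free_leibniz \<Rightarrow> 'k free_leibniz" is na_mult
proof -
  fix p p' q q' :: "'k nonassoc"
  assume "leibniz_rel p p'" "leibniz_rel q q'"
  moreover have "na_mult p q - na_mult p' q' = na_mult (p - p') q + na_mult p' (q - q')"
    by (simp add: na_mult_diff_left na_mult_diff_right)
  ultimately show "leibniz_rel (na_mult p q) (na_mult p' q')"
    unfolding leibniz_rel_def
    by (simp add: leibniz_ideal.add leibniz_ideal.mult_left leibniz_ideal.mult_right)
qed

lift_definition fl_monomial :: "magma \<Rightarrow> 'k::field free_leibniz" is "\<lambda>m. Poly_Mapping.single m 1" .

lemma leibniz_rel_refl: "p = q \<Longrightarrow> leibniz_rel p q"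
  by (simp add: leibniz_rel_def leibniz_ideal.zero)

interpretation fl: leibniz_algebra fl_scale fl_mult
proof unfold_locales
  fix x y z :: "'k::field free_leibniz"
  show "fl_mult x (fl_mult y z) = fl_mult (fl_mult x y) z - fl_mult (fl_mult x z) y"
    by transfer (simp add: leibniz_rel_def leibniz_ideal.gen)
qed (transfer; intro leibniz_rel_refl;
     simp add: na.scale_left_distrib na.scale_right_distrib na_mult_add_left na_mult_add_right
       na_mult_scale_left na_mult_scale_right)+

text \<open>The value for the empty word is irrelevant.\<close>

fun left_normed :: "nat list \<Rightarrow> 'k::field free_leibniz" where
  "left_normed [] = 0"
| "left_normed (i # is) = foldl fl_mult (fl_monomial (Var i)) (map (\<lambda>j. fl_monomial (Var j)) is)"

text \<open>\<open>P\<^bsub>n\<^esub>\<close>: the multilinear polynomials in \<open>x\<^bsub>1\<^esub>, \<dots>, x\<^bsub>n\<^esub>\<close>, i.e. in \<open>Var 0, \<dots>, Var (n - 1)\<close>.\<close>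

definition multilinear :: "nat \<Rightarrow> 'k::field free_leibniz set" where
  "multilinear n = fl.span (fl_monomial ` {m. distinct (leaves m) \<and> set (leaves m) = {..<n}})"


section \<open>Identities and codimensions of a Leibniz algebra\<close>

context leibniz_algebra
begin

primrec eval_magma :: "(nat \<Rightarrow> 'b) \<Rightarrow> magma \<Rightarrow> 'b" where
  "eval_magma \<phi> (Var i) = \<phi> i"
| "eval_magma \<phi> (Mul a b) = mult (eval_magma \<phi> a) (eval_magma \<phi> b)"

definition eval_na :: "(nat \<Rightarrow> 'b) \<Rightarrow> 'a nonassoc \<Rightarrow> 'b" where
  "eval_na \<phi> p = (\<Sum>m\<in>Poly_Mapping.keys p. scale (Poly_Mapping.lookup p m) (eval_magma \<phi> m))"

lemma eval_na_superset:
  assumes "finite A" "Poly_Mapping.keys p \<subseteq> A"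
  shows "eval_na \<phi> p = (\<Sum>m\<in>A. scale (Poly_Mapping.lookup p m) (eval_magma \<phi> m))"
  unfolding eval_na_def using assms by (intro sum.mono_neutral_left) (auto simp: in_keys_iff)

lemma eval_na_zero [simp]: "eval_na \<phi> 0 = 0"
  by (simp add: eval_na_def)

lemma eval_na_single [simp]: "eval_na \<phi> (Poly_Mapping.single m c) = scale c (eval_magma \<phi> m)"
  by (subst eval_na_superset[of "{m}"]) (auto simp: in_keys_iff lookup_single when_def)

lemma eval_na_add: "eval_na \<phi> (p + q) = eval_na \<phi> p + eval_na \<phi> q"
proof -
  let ?A = "Poly_Mapping.keys p \<union> Poly_Mapping.keys q"
  have "Poly_Mapping.keys (p + q) \<subseteq> ?A"
    by (rule Poly_Mapping.keys_add)
  then show ?thesis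
    by (subst (1 2 3) eval_na_superset[of ?A])
      (auto simp: lookup_add scale_left_distrib sum.distrib)
qed

lemma eval_na_scale: "eval_na \<phi> (na_scale c p) = scale c (eval_na \<phi> p)"
proof -
  have "Poly_Mapping.keys (na_scale c p) \<subseteq> Poly_Mapping.keys p"
    by (auto simp: in_keys_iff)
  then show ?thesis
    by (subst (1 2) eval_na_superset[of "Poly_Mapping.keys p"]) (auto simp: scale_sum_right)
qed

lemma eval_na_diff: "eval_na \<phi> (p - q) = eval_na \<phi> p - eval_na \<phi> q"
  using eval_na_add[of \<phi> "p - q" q] by (simp add: algebra_simps)

lemma eval_na_sum: "eval_na \<phi> (\<Sum>i\<in>A. f i) = (\<Sum>i\<in>A. eval_na \<phi> (f i))"
  by (induction A rule: infinite_finite_induct) (auto simp: eval_na_add)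

lemma eval_na_mult: "eval_na \<phi> (na_mult p q) = mult (eval_na \<phi> p) (eval_na \<phi> q)"
proof -
  have "mult (eval_na \<phi> p) (eval_na \<phi> q) = (\<Sum>a\<in>Poly_Mapping.keys p. \<Sum>b\<in>Poly_Mapping.keys q.
      scale (Poly_Mapping.lookup p a * Poly_Mapping.lookup q b)
        (mult (eval_magma \<phi> a) (eval_magma \<phi> b)))"
    unfolding eval_na_def by (subst mult_sum_left)
      (simp add: mult_sum_right mult_scale_left mult_scale_right mult.commute)
  then show ?thesis
    by (simp add: na_mult_def eval_na_sum)
qed

lemma eval_na_leibniz_ideal: "p \<in> leibniz_ideal \<Longrightarrow> eval_na \<phi> p = 0"
  by (induction rule: leibniz_ideal.induct)
    (auto simp: eval_na_add eval_na_diff eval_na_scale eval_na_mult leibniz)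

text \<open>The homomorphism from the free Leibniz algebra that sends \<open>Var i\<close> to \<open>\<phi> i\<close>.\<close>

lift_definition substitute :: "(nat \<Rightarrow> 'b) \<Rightarrow> 'a free_leibniz \<Rightarrow> 'b" is eval_na
  by (auto simp: leibniz_rel_def dest!: eval_na_leibniz_ideal simp: eval_na_diff)

lemma substitute_add: "substitute \<phi> (f + g) = substitute \<phi> f + substitute \<phi> g"
  by transfer (rule eval_na_add)

lemma substitute_scale: "substitute \<phi> (fl_scale c f) = scale c (substitute \<phi> f)"
  by transfer (rule eval_na_scale)

lemma substitute_mult: "substitute \<phi> (fl_mult f g) = mult (substitute \<phi> f) (substitute \<phi> g)"
  by transfer (rule eval_na_mult)

lemma substitute_monomial: "substitute \<phi> (fl_monomial m) = eval_magma \<phi> m"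
  by transfer simp

definition T_ideal :: "'a free_leibniz set" where
  "T_ideal = {f. \<forall>\<phi>. substitute \<phi> f = 0}"

lemma subspace_T_ideal: "fl.subspace T_ideal"
  using substitute_scale[of _ 0 0]
  by (auto simp: fl.subspace_def T_ideal_def substitute_add substitute_scale)

definition codimension :: "nat \<Rightarrow> nat" where
  "codimension n = fl.quotient_dim (multilinear n) (multilinear n \<inter> T_ideal)"

definition exponent :: real where
  "exponent = lim (\<lambda>n. root n (real (codimension n)))"

end


section \<open>The algebra \<open>L\<^bsub>10\<^esub>\<close>\<close>

definition L10_table :: "'k::field \<Rightarrow> 3 \<Rightarrow> 3 \<Rightarrow> 'k^3" where
  "L10_table \<alpha> i j =
     (if i = 1 \<and> j = 3 then axis 2 1
      else if i = 2 \<and> j = 3 then \<alpha> *s axis 1 1 + axis 2 1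
      else 0)"

definition L10_mult :: "'k::field \<Rightarrow> 'k^3 \<Rightarrow> 'k^3 \<Rightarrow> 'k^3" where
  "L10_mult \<alpha> u v = (\<Sum>i\<in>UNIV. \<Sum>j\<in>UNIV. (u $ i * v $ j) *s L10_table \<alpha> i j)"

lemma L10_mult_eq:
  "L10_mult \<alpha> u v = vector [\<alpha> * u $ 2 * v $ 3, (u $ 1 + u $ 2) * v $ 3, 0]"
  by (simp add: L10_mult_def L10_table_def sum_3 vec_eq_iff forall_3 axis_def algebra_simps)

interpretation L10: leibniz_algebra "(*s)" "L10_mult \<alpha>" for \<alpha> :: "'k::field"
  by unfold_locales (simp_all add: L10_mult_eq vec_eq_iff forall_3 algebra_simps)


section \<open>The monomials\<close>

text \<open>
  The list \<open>[(j\<^bsub>1\<^esub>, m\<^bsub>1\<^esub>), \<dots>, (j\<^bsub>n\<^esub>, m\<^bsub>n\<^esub>)]\<close> encodes the left-normed product of \<open>m\<^bsub>1\<^esub>\<close> copies of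
  the generator \<open>j\<^bsub>1\<^esub>\<close>, then \<open>m\<^bsub>2\<^esub>\<close> copies of the generator \<open>j\<^bsub>2\<^esub>\<close>, and so on. List positions start
  at 0, so that \<open>m\<^bsub>i\<^esub>\<close> is \<open>snd (w ! (i - 1))\<close>.
\<close>

definition power_product :: "(nat \<times> nat) list \<Rightarrow> 'k::field free_leibniz" where
  "power_product w = left_normed (concat (map (\<lambda>(j, m). replicate m j) w))"

definition L10_words :: "(nat \<times> nat) list set" where
  "L10_words = {w. w \<noteq> [] \<and> (\<forall>(j, m) \<in> set w. m \<ge> 1) \<and>
     sorted_wrt (<) (map fst (tl w)) \<and> fst (hd w) \<notin> fst ` set (tl w)}"

definition L10_words_distinct_roots :: "nat \<Rightarrow> (nat \<times> nat) list set" where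
  "L10_words_distinct_roots q = {w \<in> L10_words.
     (\<forall>i. 2 \<le> i \<and> i < length w \<longrightarrow> snd (w ! i) < q) \<and>
     snd (w ! 0) \<le> q \<and> (1 < length w \<longrightarrow> snd (w ! 1) < q)}"

definition L10_words_no_distinct_roots :: "nat \<Rightarrow> (nat \<times> nat) list set" where
  "L10_words_no_distinct_roots q = {w \<in> L10_words.
     (\<forall>i. 2 \<le> i \<and> i < length w \<longrightarrow> snd (w ! i) < q) \<and>
     (if snd (w ! 0) = 1 then (1 < length w \<longrightarrow> snd (w ! 1) < 2 * q - 1)
      else 1 < snd (w ! 0) \<and> snd (w ! 0) < 2 * q \<and> (1 < length w \<longrightarrow> snd (w ! 1) < q))}"

end

theory Submission
  imports Defs
begin

text \<open>
  Write \<open>v\<^sub>3\<close> for the third coordinate of \<open>v\<close> and \<open>N\<close> for right multiplication by \<open>e\<^sub>3\<close>. Then \<open>u v = v\<^sub>3 N u\<close>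
  and the third coordinate of every product vanishes. So every monomial either is an identity
  of \<open>L\<^bsub>10\<^esub>\<close> or takes the value \<open>(\<Prod>j\<in>#A. (v\<^sub>j)\<^sub>3) N\<^bsup>|A|\<^esup> v\<^sub>i\<close>, where \<open>i\<close> is its first generator and \<open>A\<close> the multiset
  of the others; the words of the statement enumerate the pairs \<open>(i, A)\<close>. Over an infinite field distinct
  \<open>A\<close> give independent functions, as \<open>N\<close> is invertible on the span of \<open>e\<^sub>1\<close> and \<open>e\<^sub>2\<close>.

  Over a field of order \<open>q\<close> the exponents of the scalar factor matter only modulo \<open>q - 1\<close> (apart from
  being zero or not), and the question is which powers of \<open>N\<close> occur with a given reduced multiset
  \<open>B\<close>: these are \<open>N\<^bsup>|B| + (q - 1) m\<^esup>\<close>. As \<open>p\<close> is the characteristic polynomial of \<open>N\<close> on that plane,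
  \<open>N\<^sup>q = N\<close> if \<open>p\<close> has distinct roots, and one monomial suffices for each \<open>(i, B)\<close>. Otherwise
  \<open>N\<^bsup>q - 1\<^esup>\<close> is not scalar on the plane, and the powers for \<open>B \<noteq> {#}\<close> span a two-dimensional space
  with basis \<open>N\<^bsup>|B|\<^esup>\<close>, \<open>N\<^bsup>|B| + q - 1\<^esup>\<close>; the second one is realised by raising one exponent of \<open>B\<close>
  by \<open>q - 1\<close>.
\<close>

section \<open>Bases modulo a subspace\<close>

text \<open>Independence of a family modulo \<open>U\<close> is tested on indices, which suits
  monomials indexed by exponents. Two indices with the same vector would give a relation with
  coefficients 1 and -1, hence injectivity.\<close>

lemma (in vector_space) independent_modulo_subspaceI:
  assumes indep: "\<And>F c s. finite F \<Longrightarrow> F \<subseteq> S \<Longrightarrow> (\<Sum>s\<in>F. scale (c s) (P s)) \<in> U \<Longrightarrow> s \<in> F \<Longrightarrow> c s = 0"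
    and "0 \<in> U"
  shows "inj_on P S" "independent (P ` S)" "span (P ` S) \<inter> U \<subseteq> {0}"
proof -
  show inj: "inj_on P S"
  proof (rule inj_onI, rule ccontr)
    fix a b assume "a \<in> S" "b \<in> S" "P a = P b" "a \<noteq> b"
    then show False
      using indep[of "{a, b}" "\<lambda>x. if x = a then 1 else - 1" a] \<open>0 \<in> U\<close> by simp
  qed
  have zero: "u v = 0" if T: "finite T" "T \<subseteq> P ` S" "(\<Sum>v\<in>T. scale (u v) v) \<in> U" "v \<in> T" for T u v
  proof -
    obtain F where F: "finite F" "F \<subseteq> S" "T = P ` F"
      using T by (meson finite_subset_image)
    then have "(\<Sum>v\<in>T. scale (u v) v) = (\<Sum>s\<in>F. scale (u (P s)) (P s))"
      using inj by (simp add: sum.reindex inj_on_subset)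
    then show ?thesis
      using indep[of F "\<lambda>s. u (P s)"] F T by auto
  qed
  show "independent (P ` S)"
    unfolding independent_explicit_module
  proof (intro allI impI)
    fix T u v assume "finite T" "T \<subseteq> P ` S" "(\<Sum>v\<in>T. scale (u v) v) = 0" "v \<in> T"
    then show "u v = 0"
      using zero[of T u v] \<open>0 \<in> U\<close> by simp
  qed
  show "span (P ` S) \<inter> U \<subseteq> {0}"
  proof
    fix x assume "x \<in> span (P ` S) \<inter> U"
    then obtain T u where "finite T" "T \<subseteq> P ` S" "x = (\<Sum>v\<in>T. scale (u v) v)" "x \<in> U"
      unfolding span_explicit by auto
    then show "x \<in> {0}"
      using zero[of T u] by simp
  qed
qed

lemma (in vector_space) span_Un_subspaceE:
  assumes "x \<in> span (B \<union> U)" "subspace U"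
  obtains y u where "x = y + u" "y \<in> span B" "u \<in> U"
proof -
  have "span U = U"
    using assms(2) by (simp add: span_eq_iff)
  with assms(1) have "x \<in> {y + u | y u. y \<in> span B \<and> u \<in> U}"
    unfolding span_Un by (simp only:)
  then show ?thesis
    using that by blast
qed

lemma (in vector_space) card_le_of_span_modulo_subspace:
  assumes "finite B" "independent B'" "span B' \<inter> U \<subseteq> {0}" "B' \<subseteq> span (B \<union> U)" "subspace U"
  shows "finite B' \<and> card B' \<le> card B"
proof -
  have "\<exists>y. y \<in> span B \<and> x - y \<in> U" if "x \<in> B'" for x
  proof -
    have "x \<in> span (B \<union> U)"
      using assms(4) that by blast
    then obtain y u where "x = y + u" "y \<in> span B" "u \<in> U"
      using assms(5) by (rule span_Un_subspaceE)
    then show ?thesis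
      by (intro exI[of _ y]) simp
  qed
  then obtain g where g: "\<And>x. x \<in> B' \<Longrightarrow> g x \<in> span B" "\<And>x. x \<in> B' \<Longrightarrow> x - g x \<in> U"
    by metis
  have indep: "c s = 0"
    if F: "finite F" "F \<subseteq> B'" "(\<Sum>s\<in>F. scale (c s) (g s)) \<in> {0}" "s \<in> F" for F c s
  proof -
    have "(\<Sum>s\<in>F. scale (c s) s) = (\<Sum>s\<in>F. scale (c s) (s - g s))"
      using F(3) by (simp add: scale_right_diff_distrib sum_subtractf)
    also have "\<dots> \<in> U"
      using F g assms(5) by (intro subspace_sum subspace_scale) auto
    finally have "(\<Sum>s\<in>F. scale (c s) s) \<in> span B' \<inter> U"
      using F by (auto intro!: span_sum span_scale intro: span_base)
    then have "(\<Sum>s\<in>F. scale (c s) s) = 0"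
      using assms(3) by blast
    then show ?thesis
      using assms(2) F independentD by blast
  qed
  have "inj_on g B'" "independent (g ` B')"
    using independent_modulo_subspaceI[of B' g "{0}"] indep by blast+
  then show ?thesis
    using independent_span_bound[OF assms(1), of "g ` B'"] g(1)
    by (metis card_image finite_imageD image_subsetI)
qed

context vector_space_quotients
begin

lemma coset_eq_iff:
  assumes "subspace U"
  shows "v +o U = w +o U \<longleftrightarrow> v - w \<in> U"
proof
  assume "v +o U = w +o U"
  moreover have "v \<in> v +o U"
    using subspace_0[OF assms] by (force simp: elt_set_plus_def)
  ultimately show "v - w \<in> U"
    by (auto simp: elt_set_plus_def)
next
  assume vw: "v - w \<in> U"
  have "x - w \<in> U \<longleftrightarrow> x - v \<in> U" for x
  proof -
    have "x - w \<in> U" if "x - v \<in> U"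
      using subspace_add[OF assms that vw] by simp
    moreover have "x - v \<in> U" if "x - w \<in> U"
      using subspace_diff[OF assms that vw] by simp
    ultimately show ?thesis by blast
  qed
  moreover have "y +o U = {x. x - y \<in> U}" for y
    by (force simp: elt_set_plus_def algebra_simps)
  ultimately show "v +o U = w +o U"
    by simp
qed

lemma coset_eq_self_iff:
  assumes "subspace U"
  shows "v +o U = U \<longleftrightarrow> v \<in> U"
  using coset_eq_iff[OF assms, of v 0] by (simp add: elt_set_plus_def)

text \<open>Reduces the definition of a basis by cosets to conditions on representatives.\<close>

lemma images_form_basisI:
  assumes "subspace U" and "B \<subseteq> W" and "independent B" and disj: "span B \<inter> U \<subseteq> {0}"
    and "W \<subseteq> span (B \<union> U)"
  shows "images_form_basis W U B"
proof -
  let ?q = "\<lambda>b. b +o U"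
  have inj: "inj_on ?q B"
  proof
    fix x y assume xy: "x \<in> B" "y \<in> B" "x +o U = y +o U"
    then have "x - y \<in> span B \<inter> U"
      using assms(1) by (auto simp: coset_eq_iff intro: span_diff span_base)
    with disj show "x = y" by auto
  qed
  have "quotient_independent U (?q ` B)"
    unfolding quotient_independent_def
  proof clarify
    fix F c A assume F: "finite F" "F \<subseteq> ?q ` B" "quotient_comb U c F = U" "A \<in> F"
    then obtain T where T: "T \<subseteq> B" "finite T" "F = ?q ` T"
      by (meson finite_subset_image)
    have "inj_on ?q T"
      using inj T(1) by (rule inj_on_subset)
    then have "(\<Sum>b\<in>T. scale (c (?q b)) b) \<in> U"
      using F T assms(1) by (simp add: quotient_comb_coset coset_eq_self_iff)
    moreover have "(\<Sum>b\<in>T. scale (c (?q b)) b) \<in> span B"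
      using T by (auto intro!: span_sum span_scale intro: span_base)
    ultimately have "(\<Sum>b\<in>T. scale (c (?q b)) b) = 0"
      using disj by blast
    then show "c A = 0"
      using independentD[OF assms(3) T(2,1)] F T by auto
  qed
  moreover have "\<exists>F c. finite F \<and> F \<subseteq> ?q ` B \<and> w +o U = quotient_comb U c F" if "w \<in> W" for w
  proof -
    have "w \<in> span (B \<union> U)"
      using assms(5) that by blast
    then obtain y u where yu: "w = y + u" "y \<in> span B" "u \<in> U"
      using assms(1) by (rule span_Un_subspaceE)
    then obtain T r where T: "finite T" "T \<subseteq> B" "y = (\<Sum>b\<in>T. scale (r b) b)"
      unfolding span_explicit by auto
    have injT: "inj_on ?q T"
      using inj T(2) by (rule inj_on_subset)
    \<comment> \<open>Coefficients in \<open>quotient_comb\<close> are indexed by cosets, so those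
      of the representatives are pulled back along the injective coset map.\<close>
    let ?c = "\<lambda>A. r (the_inv_into T ?q A)"
    have "(\<Sum>b\<in>T. scale (?c (?q b)) b) = y"
      unfolding T(3) by (intro sum.cong refl) (simp add: the_inv_into_f_f[OF injT])
    then have "w +o U = quotient_comb U ?c (?q ` T)"
      using yu T assms(1) injT by (simp add: quotient_comb_coset coset_eq_iff)
    moreover have "finite (?q ` T)" "?q ` T \<subseteq> ?q ` B"
      using T by auto
    ultimately show ?thesis
      by (intro exI[of _ "?q ` T"] exI[of _ ?c] conjI)
  qed
  ultimately show ?thesis
    using assms(2) inj
    by (auto simp: images_form_basis_def quotient_basis_def quotient_space_def)
qed

text \<open>Converse of the previous criterion, needed because \<open>quotient_dim\<close> counts an
  arbitrary basis picked by \<open>SOME\<close>.\<close>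

lemma quotient_basisE:
  assumes "subspace U" and C: "quotient_basis W U C"
  obtains B where "C = (\<lambda>b. b +o U) ` B" "inj_on (\<lambda>b. b +o U) B" "B \<subseteq> W"
    "independent B" "span B \<inter> U \<subseteq> {0}" "W \<subseteq> span (B \<union> U)"
proof -
  let ?q = "\<lambda>b. b +o U"
  have "C \<subseteq> ?q ` W"
    using C by (simp add: quotient_basis_def quotient_space_def)
  then obtain B where B: "B \<subseteq> W" "inj_on ?q B" "C = ?q ` B"
    by (meson subset_image_inj)
  have indep: "u v = 0"
    if T: "finite T" "T \<subseteq> B" "(\<Sum>v\<in>T. scale (u v) v) \<in> U" "v \<in> T" for T u v
  proof -
    have inj: "inj_on ?q T"
      using B(2) T(2) by (rule inj_on_subset)
    let ?c = "\<lambda>A. u (the_inv_into T ?q A)"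
    have "(\<Sum>b\<in>T. scale (?c (?q b)) b) = (\<Sum>b\<in>T. scale (u b) b)"
      by (intro sum.cong refl) (simp add: the_inv_into_f_f[OF inj])
    then have "quotient_comb U ?c (?q ` T) = U"
      using T inj assms(1) by (simp add: quotient_comb_coset coset_eq_self_iff)
    moreover have "?q ` T \<subseteq> C" "finite (?q ` T)"
      using T B by auto
    ultimately have "?c (?q v) = 0"
      using C \<open>v \<in> T\<close> unfolding quotient_basis_def quotient_independent_def by blast
    then show ?thesis
      using \<open>v \<in> T\<close> by (simp add: the_inv_into_f_f[OF inj])
  qed
  have "independent ((\<lambda>b. b) ` B)" "span ((\<lambda>b. b) ` B) \<inter> U \<subseteq> {0}"
    by (rule independent_modulo_subspaceI[where U = U]; use indep subspace_0[OF assms(1)] in blast)+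
  then have "independent B" "span B \<inter> U \<subseteq> {0}"
    by simp_all
  moreover have "W \<subseteq> span (B \<union> U)"
  proof
    fix w assume "w \<in> W"
    then have "w +o U \<in> quotient_space W U"
      by (simp add: quotient_space_def)
    then obtain F c where F: "finite F" "F \<subseteq> C" "w +o U = quotient_comb U c F"
      using C unfolding quotient_basis_def by meson
    then obtain T where T: "T \<subseteq> B" "finite T" "F = ?q ` T"
      using B(3) by (meson finite_subset_image)
    have "inj_on ?q T"
      using B(2) T(1) by (rule inj_on_subset)
    then have "w - (\<Sum>b\<in>T. scale (c (?q b)) b) \<in> U"
      using F T assms(1) by (simp add: quotient_comb_coset coset_eq_iff)
    moreover have "(\<Sum>b\<in>T. scale (c (?q b)) b) \<in> span (B \<union> U)"
      using T by (auto intro!: span_sum span_scale intro: span_base)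
    ultimately show "w \<in> span (B \<union> U)"
      by (metis UnI2 diff_add_cancel span_add span_base)
  qed
  ultimately show ?thesis
    using that B by blast
qed

lemma quotient_dim_eq_card:
  assumes "subspace U" "finite B" "B \<subseteq> W" "independent B" "span B \<inter> U \<subseteq> {0}" "W \<subseteq> span (B \<union> U)"
  shows "quotient_dim W U = card B"
proof -
  have "quotient_basis W U ((\<lambda>b. b +o U) ` B)"
    using images_form_basisI[of U B W] assms by (simp add: images_form_basis_def)
  then have "quotient_basis W U (SOME C. quotient_basis W U C)"
    by (rule someI)
  then obtain B' where B': "(SOME C. quotient_basis W U C) = (\<lambda>b. b +o U) ` B'"
    "inj_on (\<lambda>b. b +o U) B'" "B' \<subseteq> W" "independent B'" "span B' \<inter> U \<subseteq> {0}" "W \<subseteq> span (B' \<union> U)"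
    using quotient_basisE[OF assms(1)] by metis
  have "finite B' \<and> card B' \<le> card B"
    using B' assms by (intro card_le_of_span_modulo_subspace[where U = U]) auto
  \<comment> \<open>The reverse bound needs a finite spanning set, so it relies on the finiteness of
    \<open>B'\<close> just obtained.\<close>
  moreover have "finite B \<and> card B \<le> card B'"
    using B' assms \<open>finite B' \<and> _\<close> by (intro card_le_of_span_modulo_subspace[where U = U]) auto
  ultimately show ?thesis
    using B'(1,2) by (simp add: quotient_dim_def card_image)
qed

end

section \<open>Polynomial functions and reduction of exponents\<close>

text \<open>Multiplication by \<open>x \<noteq> 0\<close> permutes the nonzero elements; comparing
  their product before and after gives \<open>x ^ (q - 1) = 1\<close>.\<close>

lemma finite_field_power_card:
  fixes x :: "'k::field"
  assumes "finite (UNIV :: 'k set)"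
  shows "x ^ CARD('k) = x"
proof (cases "x = 0")
  case True
  then show ?thesis
    using assms by (simp add: card_gt_0_iff)
next
  case False
  let ?U = "UNIV - {0 :: 'k}"
  have "bij_betw ((*) x) ?U ?U"
    by (rule bij_betwI[where g = "\<lambda>y. y / x"]) (use False in auto)
  then have "(\<Prod>y\<in>?U. y) = (\<Prod>y\<in>?U. x * y)"
    by (rule prod.reindex_bij_betw[symmetric])
  also have "\<dots> = x ^ (CARD('k) - 1) * (\<Prod>y\<in>?U. y)"
    using assms by (simp add: prod.distrib card_Diff_singleton)
  finally have "x ^ (CARD('k) - 1) = 1"
    using assms by (auto simp: prod_zero_iff)
  then have "x ^ Suc (CARD('k) - 1) = x"
    by simp
  then show ?thesis
    using assms by (simp add: card_gt_0_iff)
qed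

lemma two_le_card_field:
  assumes "finite (UNIV :: 'k::field set)"
  shows "2 \<le> CARD('k)"
proof -
  have "card {0, 1 :: 'k} \<le> CARD('k)"
    by (rule card_mono) (use assms in auto)
  then show ?thesis by simp
qed

text \<open>A nonzero polynomial has at most as many roots as its degree, and the degree of this one
  would be an exponent in \<open>E\<close>.\<close>

lemma polynomial_function_eq_0:
  fixes d :: "nat \<Rightarrow> 'k::field"
  assumes "finite E" and deg: "\<And>e. e \<in> E \<Longrightarrow> infinite (UNIV :: 'k set) \<or> e < CARD('k)"
    and zero: "\<And>s. (\<Sum>e\<in>E. d e * s ^ e) = 0" and "e \<in> E"
  shows "d e = 0"
proof -
  let ?p = "\<Sum>e\<in>E. monom (d e) e"
  have coeff: "coeff ?p n = (if n \<in> E then d n else 0)" for n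
    using assms(1) by (simp add: coeff_sum)
  have roots: "{x. poly ?p x = 0} = UNIV"
    using zero by (simp add: poly_sum poly_monom)
  have "?p = 0"
  proof (rule ccontr)
    assume nz: "?p \<noteq> 0"
    then have fin: "finite (UNIV :: 'k set)"
      using poly_roots_finite[OF nz] roots by simp
    have "degree ?p \<in> E"
      using coeff[of "degree ?p"] nz by (metis leading_coeff_0_iff)
    moreover have "CARD('k) \<le> degree ?p"
      using card_poly_roots_bound[OF nz] roots by simp
    ultimately show False
      using deg fin by force
  qed
  then show ?thesis
    using coeff[of e] \<open>e \<in> E\<close> by simp
qed

text \<open>Multisets stand for monomials. Induction on the set of occurring variables: for a
  variable \<open>x\<close>, the univariate case separates the powers of \<open>x\<close>, and the
  monomials sharing one power of \<open>x\<close> are compared with \<open>x\<close>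
  deleted.\<close>

lemma multivariate_polynomial_function_eq_0:
  fixes d :: "'i \<Rightarrow> 'k::field" and A :: "'i \<Rightarrow> 'x multiset"
  assumes "finite I" "inj_on A I"
    and deg: "\<And>i x. i \<in> I \<Longrightarrow> infinite (UNIV :: 'k set) \<or> count (A i) x < CARD('k)"
    and zero: "\<And>t. (\<Sum>i\<in>I. d i * (\<Prod>x\<in>#A i. t x)) = 0"
    and "i \<in> I"
  shows "d i = 0"
proof -
  have "finite (\<Union>i\<in>I. set_mset (A i))"
    using assms(1) by simp
  then show ?thesis
    using assms
  proof (induction "\<Union>i\<in>I. set_mset (A i)" arbitrary: I A i rule: finite_psubset_induct)
    case psubset
    show ?case
    proof (cases "A ` I \<subseteq> {{#}}")
      case True
      then have "I = {i}"
        using psubset.prems(2,5) by (auto simp: inj_on_def image_subset_iff) 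
      then show ?thesis
        using psubset.prems(4)[of "\<lambda>_. 1"] True by simp
    next
      case False
      then obtain k x where kx: "k \<in> I" "x \<in># A k"
        by (metis imageE insertI1 multiset_nonemptyE subsetI)
      let ?c = "\<lambda>i. count (A i) x" and ?A = "\<lambda>i. filter_mset (\<lambda>y. y \<noteq> x) (A i)"
      \<comment> \<open>The monomials with the same power of \<open>x\<close> as monomial
        \<open>i\<close>; among them, deleting \<open>x\<close> remains injective.\<close>
      let ?J = "{j \<in> I. ?c j = ?c i}"
      have split: "A i = ?A i + replicate_mset (?c i) x" for i
        by (rule multiset_eqI) auto
      have upd: "(\<Prod>y\<in>#A i. (t(x := s)) y) = s ^ ?c i * (\<Prod>y\<in>#?A i. t y)" for i t and s :: 'k
      proof -
        have "image_mset (t(x := s)) (?A i) = image_mset t (?A i)"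
          by (rule image_mset_cong) auto
        then have "image_mset (t(x := s)) (?A i + replicate_mset (?c i) x)
            = image_mset t (?A i) + replicate_mset (?c i) s"
          by (simp only: image_mset_union image_replicate_mset fun_upd_same)
        then have "(\<Prod>y\<in>#?A i + replicate_mset (?c i) x. (t(x := s)) y)
            = (\<Prod>y\<in>#?A i. t y) * s ^ ?c i"
          by (simp only: prod_mset.union prod_mset_replicate_mset)
        then show ?thesis
          unfolding split[of i, symmetric] by (simp only: mult.commute)
      qed
      have "(\<Sum>j\<in>?J. d j * (\<Prod>y\<in>#?A j. t y)) = 0" for t
      proof (rule polynomial_function_eq_0[of "?c ` I" "\<lambda>e. \<Sum>j\<in>{j \<in> I. ?c j = e}. d j * (\<Prod>y\<in>#?A j. t y)"])
        fix s :: 'k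
        have "0 = (\<Sum>j\<in>I. d j * (\<Prod>y\<in>#A j. (t(x := s)) y))"
          using psubset.prems(4) by simp
        also have "\<dots> = (\<Sum>j\<in>I. d j * (\<Prod>y\<in>#?A j. t y) * s ^ ?c j)"
          unfolding upd by (simp add: mult_ac)
        also have "\<dots> = (\<Sum>e\<in>?c ` I. \<Sum>j\<in>{j \<in> I. ?c j = e}. d j * (\<Prod>y\<in>#?A j. t y) * s ^ ?c j)"
          by (rule sum.image_gen[OF psubset.prems(1)])
        also have "\<dots> = (\<Sum>e\<in>?c ` I. (\<Sum>j\<in>{j \<in> I. ?c j = e}. d j * (\<Prod>y\<in>#?A j. t y)) * s ^ e)"
          by (simp add: sum_distrib_right)
        finally show "(\<Sum>e\<in>?c ` I. (\<Sum>j\<in>{j \<in> I. ?c j = e}. d j * (\<Prod>y\<in>#?A j. t y)) * s ^ e) = 0"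
          by simp
      qed (use psubset.prems in auto)
      moreover have "(\<Union>j\<in>?J. set_mset (?A j)) \<subset> (\<Union>i\<in>I. set_mset (A i))"
        using kx by (auto simp: psubset_eq)
      moreover have "inj_on ?A ?J"
      proof (rule inj_onI)
        fix j j' assume "j \<in> ?J" "j' \<in> ?J" "?A j = ?A j'"
        then have "A j = A j'" "j \<in> I" "j' \<in> I"
          using split[of j] split[of j'] by auto
        then show "j = j'"
          using psubset.prems(2) by (auto dest: inj_onD)
      qed
      ultimately show ?thesis
        using psubset.prems(1,3,5) by (intro psubset.hyps(2)[of ?A ?J]) auto
    qed
  qed
qed

section \<open>Reduction of exponents modulo \<open>q - 1\<close>\<close>

text \<open>For \<open>q \<ge> 2\<close>, positive exponents are represented in
  \<open>1, ..., q - 1\<close>. The exponent 0 stays apart, since \<open>y ^ 0\<close> and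
  \<open>y ^ (q - 1)\<close> differ at \<open>y = 0\<close>.\<close>

definition reduce_exponent :: "nat \<Rightarrow> nat \<Rightarrow> nat" where
  "reduce_exponent q n = (if n = 0 then 0 else Suc ((n - 1) mod (q - 1)))"

definition reduce_mset :: "nat \<Rightarrow> 'x multiset \<Rightarrow> 'x multiset" where
  "reduce_mset q A = Abs_multiset (\<lambda>x. reduce_exponent q (count A x))"

lemma count_reduce_mset: "count (reduce_mset q A) x = reduce_exponent q (count A x)"
proof -
  have "{x. 0 < reduce_exponent q (count A x)} \<subseteq> set_mset A"
    by (auto simp: reduce_exponent_def intro: ccontr)
  then have "finite {x. 0 < reduce_exponent q (count A x)}"
    using finite_subset by blast
  then show ?thesis
    by (simp add: reduce_mset_def)
qed

lemma set_mset_reduce_mset [simp]: "set_mset (reduce_mset q A) = set_mset A"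
  by (rule set_eqI) (simp add: count_reduce_mset reduce_exponent_def flip: count_greater_zero_iff)

lemma reduce_mset_eq_empty_iff [simp]: "reduce_mset q A = {#} \<longleftrightarrow> A = {#}"
  by (metis set_mset_reduce_mset set_mset_eq_empty_iff)

lemma reduce_exponent_less:
  assumes "2 \<le> q"
  shows "reduce_exponent q n < q"
proof -
  have "(n - 1) mod (q - 1) < q - 1"
    using assms by simp
  then have "Suc ((n - 1) mod (q - 1)) < q"
    by linarith
  then show ?thesis
    using assms by (simp add: reduce_exponent_def)
qed

lemma reduce_exponent_eq_self: "n < q \<Longrightarrow> reduce_exponent q n = n"
  by (auto simp: reduce_exponent_def)

lemma reduce_exponent_add: "0 < n \<Longrightarrow> reduce_exponent q (n + (q - 1)) = reduce_exponent q n"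
  by (cases n) (simp_all add: reduce_exponent_def)

lemma reduce_exponent_diff: "\<exists>m. n = reduce_exponent q n + (q - 1) * m"
proof (cases n)
  case (Suc k)
  then have "n = reduce_exponent q n + (q - 1) * (k div (q - 1))"
    by (simp add: reduce_exponent_def)
  then show ?thesis ..
qed (simp add: reduce_exponent_def)

text \<open>The size is the power of \<open>L10_op\<close> that goes with a monomial; reduction
  lowers it by a multiple of \<open>q - 1\<close>.\<close>

lemma size_reduce_mset: "\<exists>m. size A = size (reduce_mset q A) + (q - 1) * m"
proof -
  obtain m where m: "\<And>x. count A x = reduce_exponent q (count A x) + (q - 1) * m x"
    using reduce_exponent_diff[of "count A x" q for x] by metis
  have "size A = (\<Sum>x\<in>set_mset A. reduce_exponent q (count A x) + (q - 1) * m x)"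
    unfolding size_multiset_overloaded_eq using m by (intro sum.cong) auto
  then show ?thesis
    unfolding size_multiset_overloaded_eq
    by (auto simp: count_reduce_mset sum.distrib simp flip: sum_distrib_left)
qed

lemma prod_reduce_mset:
  fixes t :: "'x \<Rightarrow> 'k::field"
  assumes "finite (UNIV :: 'k set)"
  shows "(\<Prod>x\<in>#reduce_mset CARD('k) A. t x) = (\<Prod>x\<in>#A. t x)"
proof -
  \<comment> \<open>The spare factor \<open>y\<close> makes the identity hold at
    \<open>y = 0\<close> too.\<close>
  have step: "y ^ (m * (CARD('k) - 1)) * y = y" for y :: 'k and m
  proof (induction m)
    case (Suc m)
    have "y ^ (Suc m * (CARD('k) - 1)) * y = y ^ (m * (CARD('k) - 1)) * y ^ Suc (CARD('k) - 1)"
      by (simp add: power_add)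
    also have "Suc (CARD('k) - 1) = CARD('k)"
      using two_le_card_field[OF assms] by simp
    finally show ?case
      unfolding finite_field_power_card[OF assms] using Suc.IH by (rule trans)
  qed simp
  have "y ^ reduce_exponent CARD('k) n = y ^ n" for y :: 'k and n
  proof (cases n)
    case (Suc k)
    let ?q = "CARD('k) - 1"
    have "y ^ n = y ^ (k mod ?q) * (y ^ ((k div ?q) * ?q) * y)"
      by (simp only: Suc power_Suc2 mult.assoc[symmetric] power_add[symmetric] mod_div_mult_eq)
    then show ?thesis
      unfolding step by (auto simp: Suc reduce_exponent_def)
  qed (simp add: reduce_exponent_def)
  then show ?thesis
    by (simp add: image_prod_mset_multiplicity count_reduce_mset)
qed

section \<open>Right multiplication by \<open>e\<^sub>3\<close>\<close>

definition L10_op :: "'k::field \<Rightarrow> 'k^3 \<Rightarrow> 'k^3" where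
  "L10_op \<alpha> v = vector [\<alpha> * v $ 2, v $ 1 + v $ 2, 0]"

lemma L10_mult_eq_op: "L10_mult \<alpha> u v = v $ 3 *s L10_op \<alpha> u"
  by (simp add: L10_mult_eq L10_op_def vec_eq_iff forall_3 algebra_simps)

lemma L10_op_add: "L10_op \<alpha> (u + v) = L10_op \<alpha> u + L10_op \<alpha> v"
  and L10_op_scale: "L10_op \<alpha> (c *s v) = c *s L10_op \<alpha> v"
  and L10_op_zero [simp]: "L10_op \<alpha> 0 = 0"
  by (simp_all add: L10_op_def vec_eq_iff forall_3 algebra_simps)

lemma L10_op_sum: "L10_op \<alpha> (\<Sum>i\<in>I. f i) = (\<Sum>i\<in>I. L10_op \<alpha> (f i))"
  by (induction I rule: infinite_finite_induct) (simp_all add: L10_op_add)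

lemma L10_op_pow_zero [simp]: "(L10_op \<alpha> ^^ n) 0 = 0"
  by (induction n) simp_all

text \<open>Cayley-Hamilton for \<open>t^2 - t - \<alpha>\<close> on the plane of \<open>e_1\<close>
  and \<open>e_2\<close>; the additional application of the operator first moves \<open>v\<close>
  into that plane.\<close>

lemma L10_op_cube: "L10_op \<alpha> (L10_op \<alpha> (L10_op \<alpha> v)) = L10_op \<alpha> (L10_op \<alpha> v) + \<alpha> *s L10_op \<alpha> v"
  by (simp add: L10_op_def vec_eq_iff forall_3 algebra_simps)

text \<open>On the plane the operator has determinant \<open>- \<alpha>\<close>, hence is invertible
  there.\<close>

lemma L10_op_pow_surj:
  assumes "\<alpha> \<noteq> 0" "u $ 3 = 0"
  shows "\<exists>v. v $ 3 = 0 \<and> (L10_op \<alpha> ^^ n) v = u"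
  using assms(2)
proof (induction n arbitrary: u)
  case (Suc n)
  define w :: "'a^3" where "w = vector [u $ 2 - u $ 1 / \<alpha>, u $ 1 / \<alpha>, 0]"
  have w: "w $ 3 = 0" "L10_op \<alpha> w = u"
    using assms(1) Suc.prems by (simp_all add: w_def L10_op_def vec_eq_iff forall_3)
  obtain v where "v $ 3 = 0" "(L10_op \<alpha> ^^ n) v = w"
    using Suc.IH[OF w(1)] by blast
  then show ?case
    using w(2) by auto
qed simp

text \<open>
  The pair \<open>(f, g) = power_coeffs \<alpha> n\<close> satisfies \<open>t\<^sup>n = f t + g\<close> modulo \<open>t\<^sup>2 - t - \<alpha>\<close>.
\<close>

primrec power_coeffs :: "'k::field \<Rightarrow> nat \<Rightarrow> 'k \<times> 'k" where
  "power_coeffs \<alpha> 0 = (0, 1)"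
| "power_coeffs \<alpha> (Suc n) =
     (fst (power_coeffs \<alpha> n) + snd (power_coeffs \<alpha> n), \<alpha> * fst (power_coeffs \<alpha> n))"

text \<open>The recursion multiplies \<open>f t + g\<close> by \<open>t\<close> and replaces
  \<open>t^2\<close> by \<open>t + \<alpha>\<close>.\<close>

lemma dvd_power_coeffs:
  "[:- \<alpha>, - 1, 1:] dvd monom 1 n - [:snd (power_coeffs \<alpha> n), fst (power_coeffs \<alpha> n):]"
proof (induction n)
  case (Suc n)
  let ?f = "fst (power_coeffs \<alpha> n)" and ?g = "snd (power_coeffs \<alpha> n)"
  have "monom 1 (Suc n) - [:\<alpha> * ?f, ?f + ?g:]
      = [:0, 1:] * (monom 1 n - [:?g, ?f:]) + [:- \<alpha>, - 1, 1:] * [:?f:]"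
    by (simp add: monom_Suc algebra_simps)
  then show ?case
    unfolding power_coeffs.simps fst_conv snd_conv using Suc
    by (simp only: dvd_add dvd_mult dvd_triv_left)
qed (simp add: one_pCons)

lemma root_power:
  assumes "poly [:- \<alpha>, - 1, 1:] r = 0"
  shows "r ^ n = fst (power_coeffs \<alpha> n) * r + snd (power_coeffs \<alpha> n)"
proof -
  obtain h where "monom 1 n - [:snd (power_coeffs \<alpha> n), fst (power_coeffs \<alpha> n):] = [:- \<alpha>, - 1, 1:] * h"
    using dvd_power_coeffs by (rule dvdE)
  then have "poly (monom 1 n - [:snd (power_coeffs \<alpha> n), fst (power_coeffs \<alpha> n):]) r = 0"
    using assms by (simp only: poly_mult mult_zero_left)
  then show ?thesis
    by (simp add: poly_monom algebra_simps)
qed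

text \<open>The congruence for \<open>t^n\<close> carried over to the operator; \<open>0 < k\<close>
  places the vector in the plane, where the quadratic relation holds.\<close>

lemma L10_op_power_add:
  assumes "0 < k"
  shows "(L10_op \<alpha> ^^ (k + n)) v = fst (power_coeffs \<alpha> n) *s (L10_op \<alpha> ^^ Suc k) v
    + snd (power_coeffs \<alpha> n) *s (L10_op \<alpha> ^^ k) v"
proof (induction n)
  case (Suc n)
  obtain j where j: "k = Suc j"
    using assms by (cases k) auto
  have "(L10_op \<alpha> ^^ Suc (Suc k)) v = (L10_op \<alpha> ^^ Suc k) v + \<alpha> *s (L10_op \<alpha> ^^ k) v"
    unfolding j using L10_op_cube[of \<alpha> "(L10_op \<alpha> ^^ j) v"] by simp
  moreover have "(L10_op \<alpha> ^^ (k + Suc n)) v = fst (power_coeffs \<alpha> n) *s (L10_op \<alpha> ^^ Suc (Suc k)) v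
    + snd (power_coeffs \<alpha> n) *s (L10_op \<alpha> ^^ Suc k) v"
    using Suc by (simp add: L10_op_add L10_op_scale)
  ultimately show ?case
    by (simp add: vec_eq_iff algebra_simps)
qed simp

text \<open>Choose \<open>v\<close> with n-th image \<open>e_1\<close>; its next image is
  \<open>e_2\<close>.\<close>

lemma L10_op_powers_independent:
  assumes "\<alpha> \<noteq> 0" "\<And>v. c *s (L10_op \<alpha> ^^ n) v + d *s (L10_op \<alpha> ^^ Suc n) v = 0"
  shows "c = 0" "d = 0"
proof -
  obtain v where v: "(L10_op \<alpha> ^^ n) v = axis 1 1"
    using L10_op_pow_surj[OF assms(1), of "axis 1 1" n] by (auto simp: axis_def)
  show "c = 0" "d = 0"
    using assms(2)[of v] unfolding funpow.simps comp_def v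
    by (simp_all add: L10_op_def vec_eq_iff forall_3 axis_def)
qed

section \<open>The power \<open>t^(q - 1)\<close> modulo \<open>t^2 - t - \<alpha>\<close> over a
  field of order \<open>q\<close>\<close>

text \<open>Roots are nonzero as \<open>\<alpha> \<noteq> 0\<close>, so
  \<open>x ^ (q - 1) = 1\<close> at both of them. A polynomial \<open>f t + g\<close> taking the
  value 1 at two points is constant.\<close>

lemma power_coeffs_distinct_roots:
  fixes \<alpha> :: "'k::field"
  assumes "\<alpha> \<noteq> 0" "finite (UNIV :: 'k set)"
    and "r \<noteq> s" "poly [:- \<alpha>, - 1, 1:] r = 0" "poly [:- \<alpha>, - 1, 1:] s = 0"
  shows "power_coeffs \<alpha> (CARD('k) - 1) = (0, 1)"
proof -
  obtain f g where fg: "power_coeffs \<alpha> (CARD('k) - 1) = (f, g)"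
    by (cases "power_coeffs \<alpha> (CARD('k) - 1)")
  have *: "f * x + g = 1" if "poly [:- \<alpha>, - 1, 1:] x = 0" for x
  proof -
    have "x \<noteq> 0"
      using that assms(1) by auto
    moreover have "x ^ Suc (CARD('k) - 1) = x"
      using finite_field_power_card[OF assms(2)] two_le_card_field[OF assms(2)] by simp
    ultimately show ?thesis
      using root_power[OF that, of "CARD('k) - 1"] fg by simp
  qed
  have "f * (r - s) = (f * r + g) - (f * s + g)"
    by (simp add: algebra_simps)
  also have "\<dots> = 0"
    using *[OF assms(4)] *[OF assms(5)] by simp
  finally show ?thesis
    using *[OF assms(4)] assms(3) fg by simp
qed

text \<open>Both sides are monic of degree \<open>q\<close> and agree at all \<open>q\<close>
  elements of the field, so their difference has degree below \<open>q\<close> and \<open>q\<close>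
  roots.\<close>

lemma X_plus_const_power_card:
  fixes b :: "'k::field"
  assumes "finite (UNIV :: 'k set)"
  shows "[:b, 1:] ^ CARD('k) = monom 1 CARD('k) + [:b:]"
proof (rule poly_eqI_degree_lead_coeff[where A = UNIV and n = "CARD('k)"])
  have deg: "degree ([:b, 1:] ^ CARD('k)) = CARD('k)"
    by (simp add: degree_power_eq)
  moreover have "coeff ([:b, 1:] ^ CARD('k)) CARD('k) = 1"
    using lead_coeff_power[of "[:b, 1:]" "CARD('k)"] unfolding deg by simp
  moreover have "coeff [:b:] (CARD('k)) = 0"
    using two_le_card_field[OF assms] by (simp add: coeff_pCons split: nat.split)
  ultimately show "coeff ([:b, 1:] ^ CARD('k)) CARD('k) = coeff (monom 1 CARD('k) + [:b:]) CARD('k)"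
    "degree ([:b, 1:] ^ CARD('k)) \<le> CARD('k)"
    by simp_all
  show "degree (monom 1 CARD('k) + [:b:]) \<le> CARD('k)"
    by (rule degree_add_le) (simp_all add: degree_monom_le)
qed (simp_all add: poly_monom finite_field_power_card[OF assms])

text \<open>All \<open>q\<close> elements are roots of \<open>t^q - t\<close>, while the cofactor of
  \<open>p\<close> has degree \<open>q - 2\<close>; at least two roots are left for
  \<open>p\<close>.\<close>

lemma distinct_roots_of_dvd_X_power_card_minus_X:
  fixes p :: "'k::field poly"
  assumes fin: "finite (UNIV :: 'k set)" and dvd: "p dvd monom 1 CARD('k) - [:0, 1:]" and "degree p = 2"
  shows "\<exists>r s. r \<noteq> s \<and> poly p r = 0 \<and> poly p s = 0"
proof -
  have two: "2 \<le> CARD('k)"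
    by (rule two_le_card_field[OF fin])
  let ?D = "monom 1 CARD('k) - [:0, 1:] :: 'k poly"
  have "degree ?D = CARD('k)"
    using two unfolding diff_conv_add_uminus
    by (subst degree_add_eq_left) (simp_all add: degree_monom_eq)
  obtain h where h: "?D = p * h"
    using dvd by auto
  have "?D \<noteq> 0"
    using \<open>degree ?D = CARD('k)\<close> two by force
  then have hp: "h \<noteq> 0" "p \<noteq> 0"
    using h by auto
  then have deg: "degree h + 2 = CARD('k)"
    using \<open>degree ?D = CARD('k)\<close> h assms(3) by (simp add: degree_mult_eq)
  have "x \<in> {x. poly p x = 0} \<union> {x. poly h x = 0}" for x
  proof -
    have "poly ?D x = 0"
      by (simp add: poly_monom finite_field_power_card[OF fin])
    then show ?thesis
      unfolding h by simp
  qed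
  then have "UNIV \<subseteq> {x. poly p x = 0} \<union> {x. poly h x = 0}"
    by blast
  then have "CARD('k) \<le> card ({x. poly p x = 0} \<union> {x. poly h x = 0})"
    using finite_subset[OF subset_UNIV fin] by (intro card_mono)
  also have "\<dots> \<le> card {x. poly p x = 0} + card {x. poly h x = 0}"
    by (rule card_Un_le)
  also have "\<dots> \<le> card {x. poly p x = 0} + degree h"
    using card_poly_roots_bound[OF hp(1)] by simp
  finally have "2 \<le> card {x. poly p x = 0}"
    using deg by simp
  then obtain R where "R \<subseteq> {x. poly p x = 0}" "card R = 2"
    by (meson obtain_subset_with_card_n)
  then show ?thesis
    by (auto simp: card_2_iff)
qed

text \<open>
  If \<open>t\<^sup>q = g t\<close> modulo \<open>p\<close>, then raising \<open>t\<^sup>2 = t + \<alpha>\<close> to the power \<open>q\<close> gives \<open>g\<^sup>2 (t + \<alpha>) = g t + \<alpha>\<close>,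
  hence \<open>g = 1\<close> and \<open>p\<close> divides \<open>t\<^sup>q - t\<close>.
\<close>

lemma power_coeffs_no_distinct_roots:
  fixes \<alpha> :: "'k::field"
  assumes "\<alpha> \<noteq> 0" and fin: "finite (UNIV :: 'k set)"
    and nodist: "\<nexists>r s. r \<noteq> s \<and> poly [:- \<alpha>, - 1, 1:] r = 0 \<and> poly [:- \<alpha>, - 1, 1:] s = 0"
  shows "fst (power_coeffs \<alpha> (CARD('k) - 1)) \<noteq> 0"
proof
  let ?p = "[:- \<alpha>, - 1, 1:]" and ?q = "CARD('k)"
  define g where "g = snd (power_coeffs \<alpha> (?q - 1))"
  assume "fst (power_coeffs \<alpha> (?q - 1)) = 0"
  then have "?p dvd monom 1 (?q - 1) - [:g:]"
    using dvd_power_coeffs[of \<alpha> "?q - 1"] by (simp add: g_def)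
  then have "?p dvd [:0, 1:] * (monom 1 (?q - 1) - [:g:])"
    by (rule dvd_mult)
  moreover have "[:0, 1:] * (monom 1 (?q - 1) - [:g:]) = monom 1 ?q - [:0, g:]"
    using two_le_card_field[OF fin] by (simp add: algebra_simps flip: monom_Suc)
  ultimately have Xq: "?p dvd monom 1 ?q - [:0, g:]"
    by simp
  \<comment> \<open>A difference of powers is a multiple of the difference of the bases, here
    \<open>t + \<alpha> - t^2\<close>.\<close>
  have "?p dvd [:\<alpha>, 1:] ^ ?q - [:0, 0, 1:] ^ ?q"
  proof -
    have "[:\<alpha>, 1:] - [:0, 0, 1:] = - ?p"
      by simp
    then have "?p dvd [:\<alpha>, 1:] - [:0, 0, 1:]"
      by (metis dvd_minus_iff dvd_refl)
    then show ?thesis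
      by (metis dvd_mult2 power_diff_sumr2)
  qed
  moreover have "[:0, 0, 1:] ^ ?q = monom 1 ?q * monom (1 :: 'k) ?q"
  proof -
    have "[:0, 0, 1:] = monom (1 :: 'k) 2"
      by (simp add: monom_altdef power2_eq_square)
    then show ?thesis
      by (simp add: monom_power mult_monom mult_2)
  qed
  ultimately have "?p dvd monom 1 ?q + [:\<alpha>:] - monom 1 ?q * monom 1 ?q"
    by (simp add: X_plus_const_power_card[OF fin])
  \<comment> \<open>With \<open>x = t^q\<close> and \<open>y = g t\<close>, adding
    \<open>(x - y) (x + y - 1)\<close> turns \<open>x + \<alpha> - x^2\<close> into
    \<open>y + \<alpha> - y^2\<close>.\<close>
  moreover have "?p dvd (monom 1 ?q - [:0, g:]) * (monom 1 ?q + [:0, g:] - 1)"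
    using Xq by (rule dvd_mult2)
  ultimately have "?p dvd (monom 1 ?q + [:\<alpha>:] - monom 1 ?q * monom 1 ?q)
      + (monom 1 ?q - [:0, g:]) * (monom 1 ?q + [:0, g:] - 1)"
    by (rule dvd_add)
  also have "\<dots> = [:\<alpha>:] + [:0, g:] - [:0, g:] * [:0, g:]"
  proof -
    have "x + a - x * x + (x - y) * (x + y - 1) = a + y - y * y" for x y a :: "'k poly"
      by (simp add: algebra_simps)
    then show ?thesis .
  qed
  also have "\<dots> = [:\<alpha> - g * g * \<alpha>, g - g * g:] - ?p * [:g * g:]"
    by (simp add: algebra_simps)
  finally have "?p dvd [:\<alpha> - g * g * \<alpha>, g - g * g:] - ?p * [:g * g:] + ?p * [:g * g:]"
    by (rule dvd_add[OF _ dvd_triv_left])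
  then have "?p dvd [:\<alpha> - g * g * \<alpha>, g - g * g:]"
    by (simp only: diff_add_cancel)
  \<comment> \<open>A multiple of a quadratic polynomial of degree at most 1 is zero. Its
    coefficients give \<open>g^2 = 1\<close> and \<open>g = g^2\<close>.\<close>
  then have zero: "[:\<alpha> - g * g * \<alpha>, g - g * g:] = 0"
  proof (rule contrapos_pp)
    assume "[:\<alpha> - g * g * \<alpha>, g - g * g:] \<noteq> 0"
    then show "\<not> ?p dvd [:\<alpha> - g * g * \<alpha>, g - g * g:]"
      using dvd_imp_degree_le[of ?p "[:\<alpha> - g * g * \<alpha>, g - g * g:]"] by (auto split: if_splits)
  qed
  have "g = 1"
    using zero assms(1) by auto
  then show False
    using distinct_roots_of_dvd_X_power_card_minus_X[OF fin, of ?p] Xq nodist by auto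
qed

section \<open>Values of monomials and normal words\<close>

definition L10_value :: "'k::field \<Rightarrow> nat \<Rightarrow> nat multiset \<Rightarrow> (nat \<Rightarrow> 'k^3) \<Rightarrow> 'k^3" where
  "L10_value \<alpha> i A \<phi> = (\<Prod>j\<in>#A. \<phi> j $ 3) *s (L10_op \<alpha> ^^ size A) (\<phi> i)"

lemma L10_value_empty: "L10_value \<alpha> i {#} \<phi> = \<phi> i"
  by (simp add: L10_value_def)

lemma L10_mult_mult: "L10_mult \<alpha> u (L10_mult \<alpha> v w) = 0"
  by (simp add: L10_mult_eq_op L10_op_def)

lemma L10_mult_value: "L10_mult \<alpha> (L10_value \<alpha> i A \<phi>) (\<phi> j) = L10_value \<alpha> i (add_mset j A) \<phi>"
  by (simp add: L10_mult_eq_op L10_value_def L10_op_scale)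

lemma substitute_left_normed:
  "L10.substitute \<alpha> \<phi> (left_normed (i # js)) = L10_value \<alpha> i (mset js) \<phi>"
proof (induction js rule: rev_induct)
  case Nil
  then show ?case
    by (simp add: L10.substitute_monomial L10_value_empty)
next
  case (snoc j js)
  then show ?case
    by (simp add: L10.substitute_mult L10.substitute_monomial L10_mult_value)
qed

text \<open>A product whose right factor is itself a product evaluates to 0. The surviving monomials
  are left-normed, and their value depends only on the first leaf and the multiset of the
  others.\<close>

lemma eval_magma_cases:
  obtains "\<And>\<phi>. L10.eval_magma \<alpha> \<phi> m = 0"
  | i A where "mset (leaves m) = add_mset i A" "\<And>\<phi>. L10.eval_magma \<alpha> \<phi> m = L10_value \<alpha> i A \<phi>"
proof -
  have "(\<forall>\<phi>. L10.eval_magma \<alpha> \<phi> m = 0) \<or>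
      (\<exists>i A. mset (leaves m) = add_mset i A \<and> (\<forall>\<phi>. L10.eval_magma \<alpha> \<phi> m = L10_value \<alpha> i A \<phi>))"
  proof (induction m)
    case (Var i)
    show ?case
      by (rule disjI2, rule exI[of _ i], rule exI[of _ "{#}"]) (simp add: L10_value_empty)
  next
    case (Mul a b)
    show ?case
    proof (cases b)
      case (Var j)
      show ?thesis
        using Mul.IH(1)
      proof
        assume "\<exists>i A. mset (leaves a) = add_mset i A \<and> (\<forall>\<phi>. L10.eval_magma \<alpha> \<phi> a = L10_value \<alpha> i A \<phi>)"
        then obtain i A where "mset (leaves a) = add_mset i A" "\<And>\<phi>. L10.eval_magma \<alpha> \<phi> a = L10_value \<alpha> i A \<phi>"
          by blast
        then have "mset (leaves (Mul a b)) = add_mset i (add_mset j A)"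
          "L10.eval_magma \<alpha> \<phi> (Mul a b) = L10_value \<alpha> i (add_mset j A) \<phi>" for \<phi>
          using Var by (simp_all add: L10_mult_value)
        then show ?thesis by blast
      qed simp
    next
      case (Mul c d)
      then show ?thesis
        by (simp only: L10.eval_magma.simps L10_mult_mult simp_thms)
    qed
  qed
  then show ?thesis
    using that by blast
qed

lemma fl_span_monomials: "fl.span (range fl_monomial) = UNIV"
proof -
  have "x \<in> fl.span (range fl_monomial)" for x :: "'k::field free_leibniz"
  proof (induction x rule: free_leibniz.abs_induct)
    case (1 p)
    show ?case
    proof (induction p rule: update_induct)
      case const
      show ?case
        by (simp flip: zero_free_leibniz_def add: fl.span_zero)
    next
      case (update p m c)
      have "Poly_Mapping.update m c p = p + Poly_Mapping.single m c"
        using update(1) by (intro poly_mapping_eqI)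
          (auto simp: lookup_update lookup_add lookup_single in_keys_iff when_def)
      moreover have "abs_free_leibniz (Poly_Mapping.single m c) = fl_scale c (fl_monomial m)"
        by (simp add: fl_monomial_def fl_scale.abs_eq na_scale_single)
      ultimately show ?case
        using update.IH by (simp flip: plus_free_leibniz.abs_eq add: fl.span_add fl.span_scale fl.span_base)
    qed
  qed
  then show ?thesis by blast
qed

lemma L10_substitute_diff: "L10.substitute \<alpha> \<phi> (f - g) = L10.substitute \<alpha> \<phi> f - L10.substitute \<alpha> \<phi> g"
  using L10.substitute_add[of \<alpha> \<phi> "f - g" g] by (simp add: algebra_simps)

lemma L10_substitute_sum: "L10.substitute \<alpha> \<phi> (\<Sum>i\<in>I. f i) = (\<Sum>i\<in>I. L10.substitute \<alpha> \<phi> (f i))"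
proof (induction I rule: infinite_finite_induct)
  case (insert x F)
  then show ?case by (simp add: L10.substitute_add)
qed (use L10_substitute_diff[of \<alpha> \<phi> 0 0] in simp_all)

section \<open>Normal words and their exponents\<close>

text \<open>\<open>A\<close> excludes the leading letter \<open>i\<close>, so the first block has
  one copy of \<open>i\<close> more than \<open>A\<close>.\<close>

definition normal_word :: "nat \<times> nat multiset \<Rightarrow> (nat \<times> nat) list" where
  "normal_word = (\<lambda>(i, A). (i, Suc (count A i)) #
     map (\<lambda>j. (j, count A j)) (sorted_list_of_set (set_mset A - {i})))"

definition normal_monomial :: "nat \<times> nat multiset \<Rightarrow> 'k::field free_leibniz" where
  "normal_monomial s = power_product (normal_word s)"

lemma count_mset_concat_replicate:
  assumes "distinct (map fst xs)"
  shows "count (mset (concat (map (\<lambda>(j, m). replicate m j) xs))) j = (case map_of xs j of None \<Rightarrow> 0 | Some n \<Rightarrow> n)"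
  using assms
proof (induction xs)
  case (Cons x xs)
  obtain i m where "x = (i, m)"
    by fastforce
  then show ?case
    using Cons by (auto split: option.splits dest: map_of_SomeD simp: map_of_eq_None_iff) force
qed simp

lemma normal_monomial_eq:
  "\<exists>js. normal_monomial (i, A) = left_normed (i # js) \<and> mset js = A"
proof -
  let ?xs = "map (\<lambda>j. (j, count A j)) (sorted_list_of_set (set_mset A - {i}))"
  let ?js = "replicate (count A i) i @ concat (map (\<lambda>(j, m). replicate m j) ?xs)"
  have "distinct (map fst ?xs)"
    by (simp add: comp_def)
  then have "count (mset (concat (map (\<lambda>(j, m). replicate m j) ?xs))) x
      = (if x = i then 0 else count A x)" for x
    unfolding count_mset_concat_replicate[OF \<open>distinct (map fst ?xs)\<close>]
    by (auto simp: map_of_map_restrict restrict_map_def comp_def not_in_iff)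
  then have "mset ?js = A"
    by (intro multiset_eqI) simp
  moreover have "normal_monomial (i, A) = left_normed (i # ?js)"
    by (simp add: normal_monomial_def normal_word_def power_product_def)
  ultimately show ?thesis by blast
qed

lemma substitute_normal_monomial:
  "L10.substitute \<alpha> \<phi> (normal_monomial (i, A)) = L10_value \<alpha> i A \<phi>"
  using normal_monomial_eq[of i A] by (metis substitute_left_normed)

lemma normal_word_in_L10_words: "normal_word s \<in> L10_words"
proof -
  obtain i A where s: "s = (i, A)" by fastforce
  show ?thesis
    unfolding s L10_words_def normal_word_def
    by (auto simp: comp_def Suc_le_eq)
qed

lemma L10_words_eq: "L10_words = range normal_word"
proof
  show "range normal_word \<subseteq> L10_words"
    using normal_word_in_L10_words by blast
  show "L10_words \<subseteq> range normal_word"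
  proof
    fix w assume w: "w \<in> L10_words"
    then obtain i m xs where wxs: "w = (i, m) # xs"
      unfolding L10_words_def by (metis (mono_tags, lifting) list.exhaust mem_Collect_eq surj_pair)
    have m: "1 \<le> m" and pos: "\<And>j n. (j, n) \<in> set xs \<Longrightarrow> 1 \<le> n"
      and sorted: "sorted_wrt (<) (map fst xs)" and i: "i \<notin> fst ` set xs"
      using w unfolding L10_words_def wxs by auto
    have dist: "distinct (map fst xs)"
      using sorted by (simp add: strict_sorted_iff)
    let ?B = "mset (concat (map (\<lambda>(j, m). replicate m j) xs))"
    \<comment> \<open>One of the \<open>m\<close> copies in the first block is the leading
      letter.\<close>
    let ?A = "replicate_mset (m - 1) i + ?B"
    have B: "count ?B j = (case map_of xs j of None \<Rightarrow> 0 | Some n \<Rightarrow> n)" for j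
      by (rule count_mset_concat_replicate[OF dist])
    have "map_of xs i = None"
      using i by (simp add: map_of_eq_None_iff)
    then have Ai: "Suc (count ?A i) = m"
      using B[of i] m by simp
    have Aj: "count ?A j = n" if "(j, n) \<in> set xs" for j n
    proof -
      have "map_of xs j = Some n" "j \<noteq> i"
        using that dist i by (force simp: map_of_eq_Some_iff)+
      then show ?thesis
        using B[of j] by simp
    qed
    have "set_mset ?A - {i} = set (map fst xs)"
    proof (rule set_eqI)
      fix j
      show "j \<in> set_mset ?A - {i} \<longleftrightarrow> j \<in> set (map fst xs)"
      proof (cases "j = i")
        case False
        then have "count ?A j = count ?B j"
          by simp
        moreover have "0 < count ?B j \<longleftrightarrow> j \<in> fst ` set xs"
        proof (cases "map_of xs j")
          case None
          then show ?thesis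
            using None[unfolded map_of_eq_None_iff] unfolding B None by simp
        next
          case (Some n)
          then have "(j, n) \<in> set xs"
            by (rule map_of_SomeD)
          then have "0 < n" "j \<in> fst ` set xs"
            using pos by force+
          then show ?thesis
            unfolding B by (simp add: Some)
        qed
        ultimately show ?thesis
          using False by (metis Diff_iff count_greater_zero_iff list.set_map singletonD)
      qed (use i in simp)
    qed
    then have list: "sorted_list_of_set (set_mset ?A - {i}) = map fst xs"
      using sorted by (simp only: strict_sorted_iff sorted_list_of_set.idem_if_sorted_distinct)
    have "map (\<lambda>j. (j, count ?A j)) (map fst xs) = xs"
      unfolding map_map by (rule map_idI) (use Aj in force)
    then have "normal_word (i, ?A) = w"
      unfolding normal_word_def prod.case list Ai wxs by simp
    then show "w \<in> range normal_word"
      by (metis rangeI)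
  qed
qed

text \<open>For \<open>j = i\<close> the bound reads \<open>m_1 \<le> q\<close> in terms of the
  word, because of the leading letter.\<close>

definition reduced_exponents :: "nat \<Rightarrow> (nat \<times> nat multiset) set" where
  "reduced_exponents q = {(i, A). \<forall>j. count A j < q}"

text \<open>
  The second letter of the normal word of \<open>(i, A)\<close>. For \<open>A = {#}\<close> it is meaningless, but then all exponents
  are 0 and the bound below holds anyway.
\<close>

definition pivot :: "nat \<Rightarrow> nat multiset \<Rightarrow> nat" where
  "pivot i A = (if i \<in># A then i else Min (set_mset A))"

text \<open>The larger bound leaves room to raise a reduced pivot exponent once by
  \<open>q - 1\<close>.\<close>

definition pivot_reduced_exponents :: "nat \<Rightarrow> (nat \<times> nat multiset) set" where
  "pivot_reduced_exponents q = {(i, A). \<forall>j. count A j < (if j = pivot i A then 2 * q - 1 else q)}"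

lemma normal_word_nth:
  fixes i :: nat and A :: "nat multiset"
  defines "xs \<equiv> sorted_list_of_set (set_mset A - {i})"
  shows "length (normal_word (i, A)) = Suc (length xs)"
    and "normal_word (i, A) ! 0 = (i, Suc (count A i))"
    and "k < length xs \<Longrightarrow> normal_word (i, A) ! Suc k = (xs ! k, count A (xs ! k))"
  by (simp_all add: normal_word_def xs_def)

lemma L10_words_distinct_roots_eq:
  "L10_words_distinct_roots q = normal_word ` reduced_exponents q"
proof -
  have "((\<forall>k. 2 \<le> k \<and> k < length (normal_word (i, A)) \<longrightarrow> snd (normal_word (i, A) ! k) < q) \<and>
      snd (normal_word (i, A) ! 0) \<le> q \<and>
      (1 < length (normal_word (i, A)) \<longrightarrow> snd (normal_word (i, A) ! 1) < q))
    \<longleftrightarrow> (i, A) \<in> reduced_exponents q" (is "?L \<longleftrightarrow> ?R") for i A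
  proof -
    let ?xs = "sorted_list_of_set (set_mset A - {i})"
    have "?L \<longleftrightarrow> (\<forall>k<length ?xs. count A (?xs ! k) < q) \<and> count A i < q"
    proof
      assume L: ?L
      have "count A (?xs ! k) < q" if k: "k < length ?xs" for k
      proof -
        have "snd (normal_word (i, A) ! Suc k) < q"
          using L k by (cases k) (simp_all add: normal_word_nth(1))
        then show ?thesis
          using normal_word_nth(3)[OF k] by simp
      qed
      with L show "(\<forall>k<length ?xs. count A (?xs ! k) < q) \<and> count A i < q"
        by (simp add: normal_word_nth(2) Suc_le_eq)
    next
      assume R: "(\<forall>k<length ?xs. count A (?xs ! k) < q) \<and> count A i < q"
      have "snd (normal_word (i, A) ! k) < q" if "0 < k" "k < length (normal_word (i, A))" for k
      proof -
        obtain l where "k = Suc l" "l < length ?xs"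
          using \<open>k < _\<close> \<open>0 < k\<close> unfolding normal_word_nth(1) by (cases k) auto
        then show ?thesis
          using R by (simp add: normal_word_nth(3))
      qed
      with R show ?L
        by (simp add: normal_word_nth(2))
    qed
    also have "\<dots> \<longleftrightarrow> (\<forall>j\<in>set ?xs. count A j < q) \<and> count A i < q"
      by (simp only: all_set_conv_all_nth)
    also have "\<dots> \<longleftrightarrow> ?R"
    proof (intro iffI)
      assume L: "(\<forall>j\<in>set ?xs. count A j < q) \<and> count A i < q"
      have "count A j < q" for j
      proof (cases "j \<in># A \<and> j \<noteq> i")
        case False
        then have "count A j = 0 \<or> j = i"
          by (auto simp: not_in_iff)
        with L show ?thesis by auto
      qed (use L in simp)
      then show ?R
        by (simp add: reduced_exponents_def)
    qed (simp add: reduced_exponents_def)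
    finally show ?thesis .
  qed
  then show ?thesis
    unfolding L10_words_distinct_roots_def L10_words_eq by (auto simp: image_iff)
qed

lemma filter_range_eq_image:
  assumes "\<And>s. P (g s) \<longleftrightarrow> s \<in> S"
  shows "{w \<in> range g. P w} = g ` S"
  using assms by auto

text \<open>If \<open>m_1 = 1\<close>, then \<open>i\<close> is not in \<open>A\<close> and the
  pivot is the second letter, if there is one. If \<open>m_1 > 1\<close>, the pivot is
  \<open>i\<close>, and \<open>count A i < 2 * q - 1\<close> becomes
  \<open>m_1 < 2 * q\<close>.\<close>

lemma L10_words_no_distinct_roots_eq:
  assumes "2 \<le> q"
  shows "L10_words_no_distinct_roots q = normal_word ` pivot_reduced_exponents q"
proof -
  have "((\<forall>k. 2 \<le> k \<and> k < length (normal_word (i, A)) \<longrightarrow> snd (normal_word (i, A) ! k) < q) \<and>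
      (if snd (normal_word (i, A) ! 0) = 1
       then 1 < length (normal_word (i, A)) \<longrightarrow> snd (normal_word (i, A) ! 1) < 2 * q - 1
       else 1 < snd (normal_word (i, A) ! 0) \<and> snd (normal_word (i, A) ! 0) < 2 * q \<and>
         (1 < length (normal_word (i, A)) \<longrightarrow> snd (normal_word (i, A) ! 1) < q)))
    \<longleftrightarrow> (i, A) \<in> pivot_reduced_exponents q" (is "?L \<longleftrightarrow> ?R") for i A
  proof -
    let ?xs = "sorted_list_of_set (set_mset A - {i})"
    have later: "(\<forall>k. 2 \<le> k \<and> k < length (normal_word (i, A)) \<longrightarrow> snd (normal_word (i, A) ! k) < q)
        \<longleftrightarrow> (\<forall>j\<in>set (tl ?xs). count A j < q)" (is "?P \<longleftrightarrow> ?Q")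
    proof -
      have "?Q \<longleftrightarrow> (\<forall>k<length (tl ?xs). count A (tl ?xs ! k) < q)"
        by (simp only: all_set_conv_all_nth)
      also have "\<dots> \<longleftrightarrow> ?P"
      proof
        assume R: "\<forall>k<length (tl ?xs). count A (tl ?xs ! k) < q"
        show ?P
        proof (intro allI impI)
          fix k assume "2 \<le> k \<and> k < length (normal_word (i, A))"
          then obtain l where "k = Suc (Suc l)" "Suc l < length ?xs"
            unfolding normal_word_nth(1) by (metis Suc_le_D Suc_less_eq numeral_2_eq_2 Suc_le_mono)
          then show "snd (normal_word (i, A) ! k) < q"
            using R by (simp add: normal_word_nth(3) nth_tl)
        qed
      next
        assume P: ?P
        show "\<forall>k<length (tl ?xs). count A (tl ?xs ! k) < q"
        proof (intro allI impI)
          fix k assume k: "k < length (tl ?xs)"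
          then have "Suc k < length ?xs"
            by simp
          moreover from this have "snd (normal_word (i, A) ! Suc (Suc k)) < q"
            using P by (simp add: normal_word_nth(1))
          ultimately show "count A (tl ?xs ! k) < q"
            using k by (simp add: normal_word_nth(3) nth_tl)
        qed
      qed
      finally show ?thesis by blast
    qed
    have outside: "count A j = 0" if "j \<noteq> i" "j \<notin> set ?xs" for j
      using that by (simp add: not_in_iff)
    show ?thesis
    proof (cases ?xs)
      case Nil
      then have "length (normal_word (i, A)) = 1"
        by (simp only: normal_word_nth(1)) simp
      moreover have other: "count A j = 0" if "j \<noteq> i" for j
        using outside[OF that] unfolding Nil by simp
      moreover have "?R \<longleftrightarrow> count A i < 2 * q - 1"
      proof (cases "count A i = 0")
        case True
        with other have "count A j = 0" for j
          by (cases "j = i") auto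
        then show ?thesis
          using assms by (simp add: pivot_reduced_exponents_def)
      next
        case False
        then have "pivot i A = i"
          by (simp add: pivot_def not_in_iff)
        moreover have "count A j < q" if "j \<noteq> i" for j
          using other[OF that] assms by simp
        ultimately show ?thesis
          by (auto simp: pivot_reduced_exponents_def)
      qed
      ultimately show ?thesis
        using assms unfolding later by (auto simp: normal_word_nth(2) Nil)
    next
      case (Cons y ys)
      have ys: "tl ?xs = ys"
        unfolding Cons by simp
      have "set_mset A - {i} = set ?xs"
        by simp
      then have set: "set_mset A - {i} = insert y (set ys)"
        unfolding Cons by simp
      then have y: "y \<noteq> i" "i \<notin> set ys"
        by auto
      have "distinct ?xs"
        by simp
      then have "y \<notin> set ys"
        unfolding Cons by simp
      have len: "1 < length (normal_word (i, A))" "snd (normal_word (i, A) ! 1) = count A y"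
        using normal_word_nth(3)[of 0 A i] unfolding normal_word_nth(1) Cons by simp_all
      \<comment> \<open>Generators outside the word have exponent 0, so a bound that admits 0 need
        only be checked on the letters of the word.\<close>
      have all: "(\<forall>j. P j (count A j)) \<longleftrightarrow> P i (count A i) \<and> P y (count A y) \<and> (\<forall>j\<in>set ys. P j (count A j))"
        if "\<And>j. P j 0" for P :: "nat \<Rightarrow> nat \<Rightarrow> bool"
        using that outside unfolding Cons by (metis set_ConsD)
      have "y = Min (set_mset A - {i})"
        using sorted_list_of_set_nonempty[of "set_mset A - {i}"] set Cons by simp
      then have "y = Min (set_mset A)" if "i \<notin># A"
        using that by simp
      then have pivot: "pivot i A = (if count A i = 0 then y else i)"
        unfolding pivot_def count_eq_zero_iff by simp
      have "?R \<longleftrightarrow> count A i < (if i = pivot i A then 2 * q - 1 else q) \<and>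
          count A y < (if y = pivot i A then 2 * q - 1 else q) \<and>
          (\<forall>j\<in>set ys. count A j < (if j = pivot i A then 2 * q - 1 else q))"
        unfolding pivot_reduced_exponents_def using assms
        by (simp add: all[of "\<lambda>j n. n < (if j = pivot i A then 2 * q - 1 else q)"])
      also have "(\<forall>j\<in>set ys. count A j < (if j = pivot i A then 2 * q - 1 else q)) \<longleftrightarrow> (\<forall>j\<in>set ys. count A j < q)"
        using y \<open>y \<notin> set ys\<close> by (auto simp: pivot)
      finally show ?thesis
        unfolding later ys using len assms y
        by (cases "count A i") (auto simp: normal_word_nth(2) pivot)
    qed
  qed
  note eq = this
  show ?thesis
    unfolding L10_words_no_distinct_roots_def L10_words_eq
    by (rule filter_range_eq_image) (simp only: split_paired_all eq)
qed

section \<open>Spanning and independence of normal monomials\<close>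

text \<open>Every bracketed monomial is an identity or congruent to a normal one, so spanning need
  only be checked on normal monomials.\<close>

lemma normal_monomials_span:
  assumes "\<And>i A. normal_monomial (i, A) \<in> fl.span (normal_monomial ` S \<union> L10.T_ideal \<alpha>)"
  shows "UNIV \<subseteq> fl.span (normal_monomial ` S \<union> L10.T_ideal \<alpha>)"
proof -
  have "fl_monomial m \<in> fl.span (normal_monomial ` S \<union> L10.T_ideal \<alpha>)" for m
  proof (cases m rule: eval_magma_cases[of \<alpha>])
    case 1
    then have "fl_monomial m \<in> L10.T_ideal \<alpha>"
      by (simp only: L10.T_ideal_def mem_Collect_eq L10.substitute_monomial simp_thms)
    then show ?thesis
      by (simp add: fl.span_base)
  next
    case (2 i A)
    then have "fl_monomial m - normal_monomial (i, A) \<in> L10.T_ideal \<alpha>"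
      by (simp only: L10.T_ideal_def mem_Collect_eq L10_substitute_diff L10.substitute_monomial
          substitute_normal_monomial diff_self simp_thms)
    then have "(fl_monomial m - normal_monomial (i, A)) + normal_monomial (i, A)
        \<in> fl.span (normal_monomial ` S \<union> L10.T_ideal \<alpha>)"
      by (intro fl.span_add[OF fl.span_base assms]) blast
    then show ?thesis by simp
  qed
  then have "fl.span (range fl_monomial) \<subseteq> fl.span (normal_monomial ` S \<union> L10.T_ideal \<alpha>)"
    by (intro fl.span_minimal) auto
  then show ?thesis
    unfolding fl_span_monomials .
qed

text \<open>Isolates the monomials starting with \<open>x_i\<close> and turns an identity into
  polynomial functions of the free scalars \<open>t j\<close>.\<close>

lemma T_ideal_combination:
  fixes c :: "nat \<times> nat multiset \<Rightarrow> 'k::field"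
  assumes "finite F" "(\<Sum>s\<in>F. fl_scale (c s) (normal_monomial s)) \<in> L10.T_ideal \<alpha>"
  shows "(\<Sum>s\<in>{s\<in>F. fst s = i}. (c s * (\<Prod>j\<in>#snd s. t j)) *s (L10_op \<alpha> ^^ Suc (size (snd s))) v) = 0"
proof -
  \<comment> \<open>Only generator \<open>i\<close> gets a component in the plane. One further
    application of \<open>L10_op\<close> kills the multiples of \<open>e_3\<close> that remain from
    single generators, whence the \<open>Suc\<close> in the exponent.\<close>
  define \<phi> :: "nat \<Rightarrow> 'k^3" where
    "\<phi> j = (if j = i then vector [v $ 1, v $ 2, t j] else vector [0, 0, t j])" for j
  have op: "L10_op \<alpha> (\<phi> j) = (if j = i then L10_op \<alpha> v else 0)" for j
    by (simp add: \<phi>_def L10_op_def vec_eq_iff forall_3)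
  have t: "\<phi> j $ 3 = t j" for j
    by (simp add: \<phi>_def)
  have val: "L10_op \<alpha> (L10.substitute \<alpha> \<phi> (fl_scale (c s) (normal_monomial s)))
      = (if fst s = i then (c s * (\<Prod>j\<in>#snd s. t j)) *s (L10_op \<alpha> ^^ Suc (size (snd s))) v else 0)" for s
  proof -
    have "L10_op \<alpha> (L10.substitute \<alpha> \<phi> (fl_scale (c s) (normal_monomial s)))
        = (c s * (\<Prod>j\<in>#snd s. t j)) *s (L10_op \<alpha> ^^ Suc (size (snd s))) (\<phi> (fst s))"
      using substitute_normal_monomial[of \<alpha> \<phi> "fst s" "snd s"]
      by (simp add: L10.substitute_scale L10_value_def L10_op_scale t)
    moreover have "(L10_op \<alpha> ^^ Suc n) (\<phi> (fst s)) = (if fst s = i then (L10_op \<alpha> ^^ Suc n) v else 0)" for n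
      unfolding funpow_Suc_right comp_def op by simp
    ultimately show ?thesis
      by (simp del: funpow.simps)
  qed
  have "(\<Sum>s\<in>{s\<in>F. fst s = i}. (c s * (\<Prod>j\<in>#snd s. t j)) *s (L10_op \<alpha> ^^ Suc (size (snd s))) v)
      = L10_op \<alpha> (L10.substitute \<alpha> \<phi> (\<Sum>s\<in>F. fl_scale (c s) (normal_monomial s)))"
    unfolding L10_substitute_sum L10_op_sum val using assms(1)
    by (simp only: sum.inter_filter)
  also have "\<dots> = 0"
    using assms(2) by (simp add: L10.T_ideal_def)
  finally show ?thesis .
qed

lemma reduced_exponents_independent:
  fixes c :: "nat \<times> nat multiset \<Rightarrow> 'k::field"
  assumes "\<alpha> \<noteq> 0" and F: "finite F" "(\<Sum>s\<in>F. fl_scale (c s) (normal_monomial s)) \<in> L10.T_ideal \<alpha>" "s \<in> F"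
    and deg: "infinite (UNIV :: 'k set) \<or> F \<subseteq> reduced_exponents CARD('k)"
  shows "c s = 0"
proof -
  \<comment> \<open>With this \<open>v\<close> the first coordinate of the term of \<open>s\<close>
    is \<open>c s\<close> times its scalar monomial; monomials with the same first generator differ
    in their multisets.\<close>
  obtain v where v: "(L10_op \<alpha> ^^ Suc (size (snd s))) v = axis 1 1"
    using L10_op_pow_surj[OF assms(1), of "axis 1 1" "Suc (size (snd s))"] by (auto simp: axis_def)
  let ?F = "{r \<in> F. fst r = fst s}"
  have "c s * (L10_op \<alpha> ^^ Suc (size (snd s))) v $ 1 = 0"
  proof (rule multivariate_polynomial_function_eq_0[where I = ?F and A = snd and i = s
        and d = "\<lambda>s. c s * (L10_op \<alpha> ^^ Suc (size (snd s))) v $ 1"])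
    show "inj_on snd ?F"
      by (auto simp: inj_on_def)
    show "infinite (UNIV :: 'k set) \<or> count (snd r) x < CARD('k)" if "r \<in> ?F" for r x
      using that deg by (auto simp: reduced_exponents_def)
    show "(\<Sum>r\<in>?F. c r * (L10_op \<alpha> ^^ Suc (size (snd r))) v $ 1 * (\<Prod>j\<in>#snd r. t j)) = 0" for t
      using arg_cong[OF T_ideal_combination[OF F(1,2), where i = "fst s" and t = t and v = v], of "\<lambda>u. u $ 1"]
      by (simp add: sum_component mult_ac del: funpow.simps)
  qed (use F in auto)
  then show ?thesis
    unfolding v by (simp add: axis_def)
qed

lemma normal_monomials_basis:
  fixes \<alpha> :: "'k::field"
  assumes "\<And>i A. normal_monomial (i, A) \<in> fl.span (normal_monomial ` S \<union> L10.T_ideal \<alpha>)"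
    and "\<And>F c s. finite F \<Longrightarrow> F \<subseteq> S \<Longrightarrow>
      (\<Sum>s\<in>F. fl_scale (c s) (normal_monomial s)) \<in> L10.T_ideal \<alpha> \<Longrightarrow> s \<in> F \<Longrightarrow> c s = 0"
  shows "fl.images_form_basis UNIV (L10.T_ideal \<alpha>) (normal_monomial ` S)"
proof (rule fl.images_form_basisI[OF L10.subspace_T_ideal])
  have 0: "0 \<in> L10.T_ideal \<alpha>"
    using fl.subspace_0[OF L10.subspace_T_ideal] .
  note indep = fl.independent_modulo_subspaceI[where U = "L10.T_ideal \<alpha>" and P = normal_monomial and S = S,
      OF _ 0]
  show "fl.independent (normal_monomial ` S :: 'k free_leibniz set)"
    by (rule indep(2)) (rule assms(2))
  show "fl.span (normal_monomial ` S) \<inter> L10.T_ideal \<alpha> \<subseteq> {0}"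
    by (rule indep(3)) (rule assms(2))
  show "UNIV \<subseteq> fl.span (normal_monomial ` S \<union> L10.T_ideal \<alpha>)"
    using assms(1) by (rule normal_monomials_span)
qed simp

section \<open>The bases\<close>

lemma normal_monomial_diff_in_T_ideal:
  assumes "\<And>\<phi>. L10_value \<alpha> i A \<phi> = L10_value \<alpha> i B \<phi>"
  shows "normal_monomial (i, A) - normal_monomial (i, B) \<in> L10.T_ideal \<alpha>"
  using assms by (simp only: L10.T_ideal_def mem_Collect_eq L10_substitute_diff substitute_normal_monomial
      diff_self simp_thms)

lemma basis_infinite:
  fixes \<alpha> :: "'k::field"
  assumes "\<alpha> \<noteq> 0" "infinite (UNIV :: 'k set)"
  shows "fl.images_form_basis UNIV (L10.T_ideal \<alpha>) (normal_monomial ` UNIV)"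
proof (rule normal_monomials_basis)
  show "normal_monomial (i, A) \<in> fl.span (range normal_monomial \<union> L10.T_ideal \<alpha>)" for i A
    by (simp add: fl.span_base)
qed (use reduced_exponents_independent assms in blast)

lemma basis_distinct_roots:
  fixes \<alpha> :: "'k::field"
  assumes "\<alpha> \<noteq> 0" and fin: "finite (UNIV :: 'k set)"
    and roots: "r \<noteq> s" "poly [:- \<alpha>, - 1, 1:] r = 0" "poly [:- \<alpha>, - 1, 1:] s = 0"
  shows "fl.images_form_basis UNIV (L10.T_ideal \<alpha>) (normal_monomial ` reduced_exponents CARD('k))"
proof (rule normal_monomials_basis)
  let ?q = "CARD('k)" and ?S = "reduced_exponents CARD('k)"
  \<comment> \<open>Here \<open>t^(q - 1) = 1\<close> modulo the characteristic polynomial, so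
    positive powers of the operator have period \<open>q - 1\<close>; the empty multiset is treated
    separately below.\<close>
  have period: "(L10_op \<alpha> ^^ (k + (?q - 1) * m)) v = (L10_op \<alpha> ^^ k) v" if "0 < k" for k m v
  proof (induction m)
    case (Suc m)
    have "(L10_op \<alpha> ^^ (k + (?q - 1) * Suc m)) v = (L10_op \<alpha> ^^ ((k + (?q - 1) * m) + (?q - 1))) v"
      by (simp only: mult_Suc_right add_ac)
    also have "\<dots> = (L10_op \<alpha> ^^ (k + (?q - 1) * m)) v"
      using that unfolding L10_op_power_add[OF trans_less_add1[OF that]]
        power_coeffs_distinct_roots[OF assms(1) fin roots] by simp
    finally show ?case
      using Suc by simp
  qed simp
  show "normal_monomial (i, A) \<in> fl.span (normal_monomial ` ?S \<union> L10.T_ideal \<alpha>)" for i A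
  proof -
    let ?B = "reduce_mset ?q A"
    obtain m where m: "size A = size ?B + (?q - 1) * m"
      using size_reduce_mset by blast
    have "L10_value \<alpha> i A \<phi> = L10_value \<alpha> i ?B \<phi>" for \<phi>
    proof (cases "A = {#}")
      case False
      then have "0 < size ?B"
        by (simp add: nonempty_has_size flip: nonempty_has_size)
      then show ?thesis
        unfolding L10_value_def m prod_reduce_mset[OF fin] by (simp only: period)
    qed (simp add: reduce_mset_eq_empty_iff[THEN iffD2])
    then have "normal_monomial (i, A) - normal_monomial (i, ?B) \<in> L10.T_ideal \<alpha>"
      by (rule normal_monomial_diff_in_T_ideal)
    moreover have "(i, ?B) \<in> ?S"
      by (simp add: reduced_exponents_def count_reduce_mset reduce_exponent_less two_le_card_field[OF fin])
    ultimately have "(normal_monomial (i, A) - normal_monomial (i, ?B)) + normal_monomial (i, ?B)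
        \<in> fl.span (normal_monomial ` ?S \<union> L10.T_ideal \<alpha>)"
      by (intro fl.span_add fl.span_base) auto
    then show ?thesis by simp
  qed
qed (use reduced_exponents_independent assms(1) in blast)

section \<open>Two representatives for each nonempty reduced multiset\<close>

lemma pivot_cong: "set_mset A = set_mset B \<Longrightarrow> pivot i A = pivot i B"
  by (simp add: pivot_def)

lemma pivot_in: "A \<noteq> {#} \<Longrightarrow> pivot i A \<in># A"
  by (simp add: pivot_def)

lemma set_mset_add_replicate_pivot:
  assumes "A \<noteq> {#}"
  shows "set_mset (A + replicate_mset n (pivot i A)) = set_mset A"
  using pivot_in[OF assms, of i] by auto

text \<open>Only the pivot exponent can reach \<open>q\<close>. Being at most
  \<open>2 * q - 2\<close>, it then falls into \<open>1, ..., q - 1\<close> after subtracting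
  \<open>q - 1\<close> once.\<close>

lemma pivot_reduced_exponents_cases:
  assumes "(i, A) \<in> pivot_reduced_exponents q" "2 \<le> q"
  defines "B \<equiv> reduce_mset q A"
  shows "A = B \<or> A \<noteq> {#} \<and> A = B + replicate_mset (q - 1) (pivot i B)"
proof -
  have piv: "pivot i B = pivot i A"
    by (rule pivot_cong) (simp add: B_def)
  have other: "count B j = count A j" if "j \<noteq> pivot i A" for j
    using assms(1) that
    by (auto simp: B_def count_reduce_mset pivot_reduced_exponents_def intro!: reduce_exponent_eq_self split: if_splits)
  show ?thesis
  proof (cases "count A (pivot i A) < q")
    case True
    then have "count B j = count A j" for j
      using other by (cases "j = pivot i A") (auto simp: B_def count_reduce_mset reduce_exponent_eq_self)
    then have "A = B"
      by (intro multiset_eqI) simp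
    then show ?thesis ..
  next
    case False
    define n where "n = count A (pivot i A) - (q - 1)"
    have "count A (pivot i A) < (if pivot i A = pivot i A then 2 * q - 1 else q)"
      using assms(1) unfolding pivot_reduced_exponents_def by blast
    then have n: "count A (pivot i A) = n + (q - 1)" "0 < n" "n < q"
      using False assms(2) by (auto simp: n_def)
    then have "count B (pivot i A) = n"
      unfolding B_def count_reduce_mset n(1) by (simp only: reduce_exponent_add reduce_exponent_eq_self)
    then have "A = B + replicate_mset (q - 1) (pivot i B)"
    proof (intro multiset_eqI)
      fix j
      show "count A j = count (B + replicate_mset (q - 1) (pivot i B)) j"
        unfolding piv using other n(1) \<open>count B (pivot i A) = n\<close> by (cases "j = pivot i A") simp_all
    qed
    moreover have "A \<noteq> {#}"
      using n by auto
    ultimately show ?thesis by blast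
  qed
qed

lemma reduce_mset_in_pivot_reduced_exponents:
  fixes A :: "nat multiset"
  assumes "2 \<le> q"
  defines "B \<equiv> reduce_mset q A"
  shows "(i, B) \<in> pivot_reduced_exponents q"
    and "A \<noteq> {#} \<Longrightarrow> (i, B + replicate_mset (q - 1) (pivot i B)) \<in> pivot_reduced_exponents q"
proof -
  have less: "count B j < q" for j
    using assms by (simp add: count_reduce_mset reduce_exponent_less)
  then show "(i, B) \<in> pivot_reduced_exponents q"
    by (auto simp: pivot_reduced_exponents_def intro: less_le_trans[OF less])
  assume "A \<noteq> {#}"
  then have "pivot i (B + replicate_mset (q - 1) (pivot i B)) = pivot i B"
    by (intro pivot_cong set_mset_add_replicate_pivot) (simp add: B_def)
  moreover have "count B (pivot i B) + (q - 1) < 2 * q - 1"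
    using less[of "pivot i B"] by simp
  ultimately show "(i, B + replicate_mset (q - 1) (pivot i B)) \<in> pivot_reduced_exponents q"
    using less by (auto simp: pivot_reduced_exponents_def)
qed

lemma reduce_mset_idem:
  "2 \<le> q \<Longrightarrow> reduce_mset q (reduce_mset q A) = reduce_mset q A"
  by (rule multiset_eqI) (simp add: count_reduce_mset reduce_exponent_eq_self reduce_exponent_less)

text \<open>The pivot exponent is already positive, so adding \<open>q - 1\<close> does not change
  its reduction.\<close>

lemma reduce_mset_add_pivot:
  fixes A :: "nat multiset"
  assumes "2 \<le> q" "A \<noteq> {#}"
  defines "B \<equiv> reduce_mset q A"
  shows "reduce_mset q (B + replicate_mset (q - 1) (pivot i B)) = B"
proof (rule multiset_eqI)
  fix j
  have "pivot i B \<in># B"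
    using assms(2) unfolding B_def by (intro pivot_in) simp
  then have "0 < count B (pivot i B)"
    by simp
  then have "reduce_exponent q (count (B + replicate_mset (q - 1) (pivot i B)) j) = reduce_exponent q (count B j)"
    by (cases "j = pivot i B") (simp_all only: count_union count_replicate_mset if_True if_False
        reduce_exponent_add add_0_right refl)
  also have "\<dots> = count B j"
    using reduce_mset_idem[OF assms(1), of A] unfolding B_def by (metis count_reduce_mset)
  finally show "count (reduce_mset q (B + replicate_mset (q - 1) (pivot i B))) j = count B j"
    by (simp only: count_reduce_mset)
qed

lemma basis_no_distinct_roots:
  fixes \<alpha> :: "'k::field"
  assumes "\<alpha> \<noteq> 0" and fin: "finite (UNIV :: 'k set)"
    and nodist: "\<nexists>r s. r \<noteq> s \<and> poly [:- \<alpha>, - 1, 1:] r = 0 \<and> poly [:- \<alpha>, - 1, 1:] s = 0"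
  shows "fl.images_form_basis UNIV (L10.T_ideal \<alpha>) (normal_monomial ` pivot_reduced_exponents CARD('k))"
proof (rule normal_monomials_basis)
  let ?q = "CARD('k)" and ?S = "pivot_reduced_exponents CARD('k)"
  let ?up = "\<lambda>i B. B + replicate_mset (?q - 1) (pivot i B)"
  have q: "2 \<le> ?q"
    by (rule two_le_card_field[OF fin])
  define f where "f = fst (power_coeffs \<alpha> (?q - 1))"
  define g where "g = snd (power_coeffs \<alpha> (?q - 1))"
  have f: "f \<noteq> 0"
    unfolding f_def by (rule power_coeffs_no_distinct_roots[OF assms])
  have shift: "(L10_op \<alpha> ^^ (k + (?q - 1))) v = f *s (L10_op \<alpha> ^^ Suc k) v + g *s (L10_op \<alpha> ^^ k) v"
    if "0 < k" for k v
    unfolding f_def g_def using that by (rule L10_op_power_add)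
  show "normal_monomial (i, A) \<in> fl.span (normal_monomial ` ?S \<union> L10.T_ideal \<alpha>)" for i A
  proof (cases "A = {#}")
    case True
    then have "(i, A) \<in> ?S"
      using q by (auto simp: pivot_reduced_exponents_def)
    then show ?thesis
      by (simp add: fl.span_base)
  next
    case False
    let ?B = "reduce_mset ?q A"
    obtain m where m: "size A = size ?B + (?q - 1) * m"
      using size_reduce_mset by blast
    have B: "0 < size ?B"
      using False by (simp flip: nonempty_has_size)
    define c where "c = fst (power_coeffs \<alpha> ((?q - 1) * m))"
    define d where "d = snd (power_coeffs \<alpha> ((?q - 1) * m))"
    \<comment> \<open>From \<open>t^((q - 1) m) = c t + d\<close> and
      \<open>t^(q - 1) = f t + g\<close>: eliminating \<open>t\<close>, possible as
      \<open>f \<noteq> 0\<close>, gives these coefficients.\<close>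
    let ?comb = "fl_scale (d - c / f * g) (normal_monomial (i, ?B)) + fl_scale (c / f) (normal_monomial (i, ?up i ?B))"
    have prod_up: "(\<Prod>j\<in>#?up i ?B. t j) = (\<Prod>j\<in>#A. t j)" for t :: "nat \<Rightarrow> 'k"
      using prod_reduce_mset[OF fin] reduce_mset_add_pivot[OF q False] by metis
    have "L10.substitute \<alpha> \<phi> (normal_monomial (i, A) - ?comb) = 0" for \<phi>
    proof -
      have pow: "(L10_op \<alpha> ^^ size A) v = (d - c / f * g) *s (L10_op \<alpha> ^^ size ?B) v
          + (c / f) *s (L10_op \<alpha> ^^ (size ?B + (?q - 1))) v" for v
        unfolding shift[OF B] m L10_op_power_add[OF B, where n = "(?q - 1) * m"] c_def[symmetric] d_def[symmetric]
        using f by (simp add: vec_eq_iff field_simps)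
      show ?thesis
        unfolding L10_substitute_diff L10.substitute_add L10.substitute_scale substitute_normal_monomial
          L10_value_def prod_up prod_reduce_mset[OF fin] size_union size_replicate_mset pow
        by (simp add: vec_eq_iff algebra_simps)
    qed
    then have "normal_monomial (i, A) - ?comb \<in> L10.T_ideal \<alpha>"
      by (simp only: L10.T_ideal_def mem_Collect_eq simp_thms)
    moreover have "(i, ?B) \<in> ?S" "(i, ?up i ?B) \<in> ?S"
      using reduce_mset_in_pivot_reduced_exponents[OF q] False by blast+
    ultimately have "(normal_monomial (i, A) - ?comb) + ?comb \<in> fl.span (normal_monomial ` ?S \<union> L10.T_ideal \<alpha>)"
      by (intro fl.span_add fl.span_scale fl.span_base) auto
    then show ?thesis by (simp only: diff_add_cancel)
  qed
  fix F c s
  assume F: "finite F" "F \<subseteq> ?S" "(\<Sum>s\<in>F. fl_scale (c s) (normal_monomial s)) \<in> L10.T_ideal \<alpha>" "s \<in> F"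
  define i where "i = fst s"
  define B where "B = reduce_mset ?q (snd s)"
  let ?F = "{r \<in> F. fst r = i}" and ?op = "\<lambda>r v. (L10_op \<alpha> ^^ Suc (size (snd r))) v"
  let ?G = "{r \<in> ?F. reduce_mset ?q (snd r) = B}"
  have "finite ?F"
    using F(1) by simp
  \<comment> \<open>Terms are grouped by reduced multiset. Reduced multisets give independent
    functions of \<open>t\<close>, so each group vanishes coordinatewise.\<close>
  have comp: "(\<Sum>r\<in>?G. c r * ?op r v $ k) = 0" for v k
  proof (rule multivariate_polynomial_function_eq_0[where I = "(\<lambda>r. reduce_mset ?q (snd r)) ` ?F"
        and A = "\<lambda>B. B" and i = B
        and d = "\<lambda>B. \<Sum>r\<in>{r \<in> ?F. reduce_mset ?q (snd r) = B}. c r * ?op r v $ k"])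
    fix t :: "nat \<Rightarrow> 'k"
    have "0 = (\<Sum>r\<in>?F. c r * ?op r v $ k * (\<Prod>j\<in>#snd r. t j))"
      using arg_cong[OF T_ideal_combination[OF F(1,3), where i = i and t = t and v = v], of "\<lambda>u. u $ k"]
      by (simp add: sum_component mult_ac del: funpow.simps)
    also have "\<dots> = (\<Sum>C\<in>(\<lambda>r. reduce_mset ?q (snd r)) ` ?F.
        \<Sum>r\<in>{r \<in> ?F. reduce_mset ?q (snd r) = C}. c r * ?op r v $ k * (\<Prod>j\<in>#snd r. t j))"
      by (rule sum.image_gen[OF \<open>finite ?F\<close>])
    also have "\<dots> = (\<Sum>C\<in>(\<lambda>r. reduce_mset ?q (snd r)) ` ?F.
        (\<Sum>r\<in>{r \<in> ?F. reduce_mset ?q (snd r) = C}. c r * ?op r v $ k) * (\<Prod>j\<in>#C. t j))"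
      unfolding sum_distrib_right
      by (intro sum.cong refl) (auto simp: prod_reduce_mset[OF fin] simp del: funpow.simps)
    finally show "(\<Sum>C\<in>(\<lambda>r. reduce_mset ?q (snd r)) ` ?F.
        (\<Sum>r\<in>{r \<in> ?F. reduce_mset ?q (snd r) = C}. c r * ?op r v $ k) * (\<Prod>j\<in>#C. t j)) = 0"
      by (rule sym)
  next
    show "B \<in> (\<lambda>r. reduce_mset ?q (snd r)) ` ?F"
      using F(4) by (auto simp: B_def i_def)
  qed (use \<open>finite ?F\<close> q in \<open>auto simp: count_reduce_mset reduce_exponent_less\<close>)
  have zero: "(\<Sum>r\<in>?G. c r *s ?op r v) = 0" for v
    unfolding vec_eq_iff sum_component vector_smult_component using comp by simp
  have G: "snd r = B \<or> B \<noteq> {#} \<and> snd r = ?up i B" if "r \<in> ?G" for r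
  proof -
    have "(i, snd r) \<in> ?S" "reduce_mset ?q (snd r) = B"
      using that F(2) by auto
    then show ?thesis
      using pivot_reduced_exponents_cases[of i "snd r" ?q] q by auto
  qed
  have s: "s \<in> ?G"
    using F(4) by (simp add: i_def B_def)
  show "c s = 0"
  \<comment> \<open>The empty multiset has a single representative; every other group has at most
    two.\<close>
  proof (cases "B = {#}")
    case True
    then have "?G = {s}"
      using G s by (auto simp: prod_eq_iff)
    moreover obtain v where "?op s v = axis 1 1"
      using L10_op_pow_surj[OF assms(1), of "axis 1 1" "Suc (size (snd s))"] by (auto simp: axis_def)
    ultimately show ?thesis
      using comp[of v 1] by (simp add: axis_def del: funpow.simps)
  next
    case False
    then have A: "snd s \<noteq> {#}"
      by (simp add: B_def)
    \<comment> \<open>Extending by 0 allows summing over both representatives even if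
      \<open>F\<close> contains only one.\<close>
    define c' where "c' r = (if r \<in> F then c r else 0)" for r
    let ?U = "{(i, B), (i, ?up i B)}"
    have neq: "B \<noteq> ?up i B"
      using q by (auto simp: multiset_eq_iff)
    have reduced: "reduce_mset ?q B = B" "reduce_mset ?q (?up i B) = B"
      unfolding B_def using reduce_mset_idem[OF q] reduce_mset_add_pivot[OF q A] by blast+
    have "(c' (i, B) + g * c' (i, ?up i B)) *s (L10_op \<alpha> ^^ Suc (size B)) v
        + (f * c' (i, ?up i B)) *s (L10_op \<alpha> ^^ Suc (Suc (size B))) v = 0" for v
    proof -
      have "0 = (\<Sum>r\<in>?G. c' r *s ?op r v)"
        unfolding zero[of v, symmetric] by (intro sum.cong refl) (simp add: c'_def)
      also have "\<dots> = (\<Sum>r\<in>?U. c' r *s ?op r v)"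
      proof (rule sum.mono_neutral_left)
        show "?G \<subseteq> ?U"
        proof
          fix r assume r: "r \<in> ?G"
          then have "r = (i, snd r)"
            by (cases r) auto
          with G[OF r] show "r \<in> ?U"
            by (metis insertCI)
        qed
        show "\<forall>r\<in>?U - ?G. c' r *s ?op r v = 0"
          using reduced by (auto simp: c'_def)
      qed simp
      also have "\<dots> = c' (i, B) *s (L10_op \<alpha> ^^ Suc (size B)) v
          + c' (i, ?up i B) *s (L10_op \<alpha> ^^ (Suc (size B) + (?q - 1))) v"
        using neq by (simp del: funpow.simps)
      also have "\<dots> = (c' (i, B) + g * c' (i, ?up i B)) *s (L10_op \<alpha> ^^ Suc (size B)) v
        + (f * c' (i, ?up i B)) *s (L10_op \<alpha> ^^ Suc (Suc (size B))) v"
        unfolding shift[OF zero_less_Suc] by (simp add: vec_eq_iff algebra_simps)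
      finally show ?thesis by (rule sym)
    qed
    then have "c' (i, B) + g * c' (i, ?up i B) = 0" "f * c' (i, ?up i B) = 0"
      by (rule L10_op_powers_independent[OF assms(1)])+
    then have "c' (i, B) = 0" "c' (i, ?up i B) = 0"
      using f by auto
    moreover have "s = (i, B) \<or> s = (i, ?up i B)"
      using G[OF s] i_def by (metis prod.collapse)
    ultimately show ?thesis
      using F(4) by (auto simp: c'_def)
  qed
qed

section \<open>Codimensions\<close>

lemma na_mult_single:
  "na_mult (Poly_Mapping.single a c) (Poly_Mapping.single b d) = Poly_Mapping.single (Mul a b) (c * d)"
  by (subst na_mult_superset[of "{a}" "{b}"]) auto

lemma left_normed_eq_fl_monomial:
  "\<exists>m. left_normed (i # js) = fl_monomial m \<and> leaves m = i # js"
proof (induction js rule: rev_induct)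
  case Nil
  show ?case
    by (intro exI[of _ "Var i"]) simp
next
  case (snoc j js)
  then obtain m where m: "left_normed (i # js) = (fl_monomial m :: 'a free_leibniz)" "leaves m = i # js"
    by blast
  have "fl_mult (fl_monomial m) (fl_monomial (Var j)) = (fl_monomial (Mul m (Var j)) :: 'a free_leibniz)"
    by transfer (simp add: leibniz_rel_refl na_mult_single)
  then have "left_normed (i # js @ [j]) = (fl_monomial (Mul m (Var j)) :: 'a free_leibniz)"
    using m by simp
  then show ?case
    using m by (intro exI[of _ "Mul m (Var j)"]) simp
qed

text \<open>A multilinear normal monomial is determined by its first generator, which is where the
  codimension \<open>n\<close> comes from.\<close>

definition multilinear_exponents :: "nat \<Rightarrow> (nat \<times> nat multiset) set" where
  "multilinear_exponents n = (\<lambda>i. (i, mset_set ({..<n} - {i}))) ` {..<n}"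

lemma mset_eq_mset_set:
  assumes "mset xs = mset_set S" "finite S"
  shows "distinct xs" "set xs = S"
proof -
  show "set xs = S"
    using assms by (metis finite_set_mset_mset_set set_mset_mset)
  then show "distinct xs"
    using assms by (simp add: distinct_count_atmost_1 count_mset_set')
qed

lemma normal_monomial_multilinear:
  assumes "s \<in> multilinear_exponents n"
  shows "normal_monomial s \<in> multilinear n"
proof -
  obtain i where i: "s = (i, mset_set ({..<n} - {i}))" "i < n"
    using assms by (auto simp: multilinear_exponents_def)
  obtain js where js: "normal_monomial s = (left_normed (i # js) :: 'a free_leibniz)" "mset js = mset_set ({..<n} - {i})"
    using normal_monomial_eq[where 'a = 'a, of i] i(1) by blast
  obtain m where m: "left_normed (i # js) = (fl_monomial m :: 'a free_leibniz)" "leaves m = i # js"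
    using left_normed_eq_fl_monomial by blast
  have "distinct js" "set js = {..<n} - {i}"
    using mset_eq_mset_set[OF js(2)] by simp_all
  then have "distinct (leaves m)" "set (leaves m) = {..<n}"
    using i(2) m(2) by auto
  then show ?thesis
    unfolding multilinear_def js(1) m(1) by (intro fl.span_base) blast
qed

lemma codimension_L10:
  fixes \<alpha> :: "'k::field"
  assumes "\<alpha> \<noteq> 0" "1 \<le> n"
  shows "leibniz_algebra.codimension (*s) (L10_mult \<alpha>) n = n"
proof -
  let ?S = "multilinear_exponents n" and ?W = "multilinear n :: 'k free_leibniz set" and ?T = "L10.T_ideal \<alpha>"
  let ?B = "normal_monomial ` ?S :: 'k free_leibniz set"
  \<comment> \<open>Multilinear exponents are at most 1, hence below \<open>q\<close>, so
    independence holds over finite fields too.\<close>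
  have S: "?S \<subseteq> reduced_exponents CARD('k)" if "finite (UNIV :: 'k set)"
    using two_le_card_field[OF that]
    by (auto simp: multilinear_exponents_def reduced_exponents_def count_mset_set' split: if_splits)
  have indep: "c s = 0"
    if "finite F" "F \<subseteq> ?S" "(\<Sum>s\<in>F. fl_scale (c s) (normal_monomial s)) \<in> ?T" "s \<in> F"
    for F and c :: "nat \<times> nat multiset \<Rightarrow> 'k" and s
    using that S by (intro reduced_exponents_independent[OF assms(1) that(1,3,4)]) blast
  have T: "fl.subspace ?T" "0 \<in> ?T"
    using L10.subspace_T_ideal fl.subspace_0[OF L10.subspace_T_ideal] by blast+
  note B = fl.independent_modulo_subspaceI[where U = ?T and P = normal_monomial and S = ?S, OF _ T(2)]
  have inj: "inj_on (normal_monomial :: _ \<Rightarrow> 'k free_leibniz) ?S"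
    by (rule B(1)) (rule indep)
  have ind: "fl.independent ?B"
    by (rule B(2)) (rule indep)
  have disj: "fl.span ?B \<inter> ?T \<subseteq> {0}"
    by (rule B(3)) (rule indep)
  have W: "fl.subspace ?W"
    by (simp add: multilinear_def)
  have "?W \<subseteq> fl.span (?B \<union> (?W \<inter> ?T))"
    unfolding multilinear_def
  proof (rule fl.span_minimal[OF _ fl.subspace_span], unfold multilinear_def[symmetric], safe)
    fix m assume m: "distinct (leaves m)" "set (leaves m) = {..<n}"
    then have mW: "fl_monomial m \<in> ?W"
      unfolding multilinear_def by (intro fl.span_base) blast
    show "fl_monomial m \<in> fl.span (?B \<union> (?W \<inter> ?T))"
    proof (cases m rule: eval_magma_cases[of \<alpha>])
      case 1
      then have "fl_monomial m \<in> ?T"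
        by (simp only: L10.T_ideal_def mem_Collect_eq L10.substitute_monomial simp_thms)
      with mW show ?thesis
        by (intro fl.span_base) blast
    next
      case (2 i A)
      have "add_mset i A = mset_set {..<n}"
        using m 2(1) by (metis mset_set_set)
      moreover from this have "i < n"
        by (metis finite_lessThan finite_set_mset_mset_set lessThan_iff union_single_eq_member)
      ultimately have "i < n" "A = mset_set ({..<n} - {i})"
        using mset_set.remove[of "{..<n}" i] by simp_all
      then have s: "(i, A) \<in> ?S"
        by (auto simp: multilinear_exponents_def)
      \<comment> \<open>Both monomials are multilinear, so the identity relating them lies in the
        intersection that defines the codimension.\<close>
      then have "fl_monomial m - normal_monomial (i, A) \<in> ?W"
        using mW W normal_monomial_multilinear fl.subspace_diff by blast
      moreover have "fl_monomial m - normal_monomial (i, A) \<in> ?T"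
        using 2(2) by (simp only: L10.T_ideal_def mem_Collect_eq L10_substitute_diff L10.substitute_monomial
            substitute_normal_monomial diff_self simp_thms)
      ultimately have "(fl_monomial m - normal_monomial (i, A)) + normal_monomial (i, A)
          \<in> fl.span (?B \<union> (?W \<inter> ?T))"
        using s by (intro fl.span_add fl.span_base) auto
      then show ?thesis by simp
    qed
  qed
  moreover have "finite ?B"
    by (simp add: multilinear_exponents_def)
  moreover have "?B \<subseteq> ?W"
    using normal_monomial_multilinear by blast
  moreover have "fl.subspace (?W \<inter> ?T)"
    using W T(1) by (rule fl.subspace_inter)
  ultimately have "fl.quotient_dim ?W (?W \<inter> ?T) = card ?B"
    using disj ind by (intro fl.quotient_dim_eq_card) auto
  also have "\<dots> = n"
    unfolding card_image[OF inj] by (simp add: multilinear_exponents_def card_image inj_on_def)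
  finally show ?thesis
    by (simp add: L10.codimension_def)
qed

theorem corollary3p17:
  fixes \<alpha> :: "'k::field"
  assumes "\<alpha> \<noteq> 0"
  defines "p \<equiv> [:- \<alpha>, - 1, 1:]"
    and "q \<equiv> CARD('k)"
  shows "(infinite (UNIV :: 'k set) \<longrightarrow>
            fl.images_form_basis UNIV (leibniz_algebra.T_ideal (*s) (L10_mult \<alpha>)) (power_product ` L10_words))
       \<and> (finite (UNIV :: 'k set) \<longrightarrow>
            ((\<exists>r s. r \<noteq> s \<and> poly p r = 0 \<and> poly p s = 0) \<longrightarrow>
               fl.images_form_basis UNIV (leibniz_algebra.T_ideal (*s) (L10_mult \<alpha>)) (power_product ` L10_words_distinct_roots q)) \<and>
            ((\<nexists>r s. r \<noteq> s \<and> poly p r = 0 \<and> poly p s = 0) \<longrightarrow>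
               fl.images_form_basis UNIV (leibniz_algebra.T_ideal (*s) (L10_mult \<alpha>)) (power_product ` L10_words_no_distinct_roots q)))
       \<and> (\<forall>n\<ge>1. leibniz_algebra.codimension (*s) (L10_mult \<alpha>) n = n)
       \<and> convergent (\<lambda>n. root n (real (leibniz_algebra.codimension (*s) (L10_mult \<alpha>) n)))
       \<and> leibniz_algebra.exponent (*s) (L10_mult \<alpha>) = 1"
proof -
  have image: "power_product ` normal_word ` S = normal_monomial ` S" for S
    by (simp add: image_image normal_monomial_def)
  have codim: "leibniz_algebra.codimension (*s) (L10_mult \<alpha>) n = n" if "1 \<le> n" for n
    using codimension_L10[OF assms(1) that] .
  \<comment> \<open>The codimension is known from \<open>n = 1\<close> on, so the sequence agrees
    eventually with the n-th root of \<open>n\<close>.\<close>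
  have lim: "(\<lambda>n. root n (real (leibniz_algebra.codimension (*s) (L10_mult \<alpha>) n))) \<longlonglongrightarrow> 1"
  proof (rule Lim_transform_eventually[OF LIMSEQ_root])
    show "\<forall>\<^sub>F n in sequentially. root n (real n) = root n (real (leibniz_algebra.codimension (*s) (L10_mult \<alpha>) n))"
      using eventually_ge_at_top[of 1] by eventually_elim (simp add: codim)
  qed
  show ?thesis
  proof (intro conjI impI allI)
    assume "infinite (UNIV :: 'k set)"
    then show "fl.images_form_basis UNIV (L10.T_ideal \<alpha>) (power_product ` L10_words)"
      unfolding L10_words_eq image by (rule basis_infinite[OF assms(1)])
  next
    assume "finite (UNIV :: 'k set)" "\<exists>r s. r \<noteq> s \<and> poly p r = 0 \<and> poly p s = 0"
    then show "fl.images_form_basis UNIV (L10.T_ideal \<alpha>) (power_product ` L10_words_distinct_roots q)"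
      unfolding L10_words_distinct_roots_eq image p_def q_def
      using basis_distinct_roots[OF assms(1)] by blast
  next
    assume "finite (UNIV :: 'k set)" "\<nexists>r s. r \<noteq> s \<and> poly p r = 0 \<and> poly p s = 0"
    then show "fl.images_form_basis UNIV (L10.T_ideal \<alpha>) (power_product ` L10_words_no_distinct_roots q)"
      unfolding p_def q_def L10_words_no_distinct_roots_eq[OF two_le_card_field[OF \<open>finite UNIV\<close>]] image
      by (rule basis_no_distinct_roots[OF assms(1)])
  next
    show "convergent (\<lambda>n. root n (real (leibniz_algebra.codimension (*s) (L10_mult \<alpha>) n)))"
      using lim by (rule convergentI)
    show "leibniz_algebra.exponent (*s) (L10_mult \<alpha>) = 1"
      unfolding L10.exponent_def using lim by (rule limI)
  qed (rule codim)
qed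

end
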